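(* For every rational number $\frac{p^2}{m^2}$ in the closed interval $[0,1]\subset\mathbb R$, where $p\ge 0$ and $m\ge 1$ are integers with $\gcd(p,m)=1$ and $p\le m$, let $E[p,m]$ be the curve in the $(x,y)$-plane defined, for $p\geq 1$, by $$\left(\frac{m}{p}\,x+\frac{p^2+m^2-1}{pm}\,y\right)^2+\frac{p^2}{m^2}=4xy+2x+2\,\frac{m^2-p^2+1}{m^2}\,y ,$$ and, for $(p,m)=(0,1)$, let $E[0,1]$ be the line $x=0$ (regarded as a degenerate ellipse). The curves $E[p,m]$ are called ellipses, where $E[1,1]$ is the parabola $2(x+y)=(x-y)^2+1$. Then the following hold. (A) For $p\ge 1$, each $E[p,m]$ lies above the $x$-axis (i.e. in $y\ge 0$) and is tangent to it at the point $(p^2/m^2,0)$. (B) The interiors of the ellipses $E[p,m]$, for distinct fractions $p/m$, are pairwise disjoint. Moreover, if two of the fractions $\frac pm$ and $\frac qn$ satisfy $$\det\begin{bmatrix}p&q\\ m&n\end{bmatrix}=\pm1 ,$$ then there is an ellipse inscribed between $E[p,m]$, $E[q,n]$ and the $x$-axis (i.e. tangent to all three), namely $E[p+q,m+n]$, which touches the $x$-axis at the point with $$x=\frac{(p+q)^2}{(m+n)^2}.$$ (C) If $\det\begin{bmatrix}p&q\\ m&n\end{bmatrix}=\pm1$, then $E[p,m]$ and $E[q,n]$ are mutually tangent, at the point $$E[p,m]\cap E[q,n]=\left(\frac{p^2+q^2-1}{m^2+n^2-1},\ \frac{1}{m^2+n^2-1}\right).$$ (D) For $p\ge1$, the ellipses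 coincide with plateaus of constant value of the depth function $\delta$: the interior of $E[p,m]$ (intersected with the unit square $[0,1]^2$ in the case $p=m=1$) is a plateau of $\delta$. In particular, the value of $\delta$ in the interior of $E[p,m]$ (within $[0,1]^2$) is equal to the row number of $[p,m]$ in the Stern–Brocot tree.
   Context: Depth function. The Apollonian depth is the function $\delta:\mathbb R^3\to\mathbb N\cup\{0,\infty\}$ defined as follows. $\delta(a,b,c)=0$ if any of $a,b,c$ is zero or negative. Otherwise put $T_0=(a,b,c)$ and, as long as all entries of $T_n=(a_n,b_n,c_n)$ are positive, let $T_{n+1}$ be obtained from $T_n$ by replacing the greatest of its entries by $$a_n+b_n+c_n-2\sqrt{a_nb_n+b_nc_n+c_na_n}.$$ Then $\delta(a,b,c)$ is the smallest $d$ such that $T_d$ has a zero or negative entry, and $\delta(a,b,c)=\infty$ if no such $d$ exists. (The numbers represent curvatures of three mutually tangent disks; the replacement exchanges the smallest disk for the larger of the two disks tangent to all three.) The function is invariant under permutation and under positive scaling of $(a,b,c)$. The reduced depth function on the unit square is $\delta(x,y)=\delta(1,x,y)$ for $(x,y)\in[0,1]^2$. Plateaus. A plateau of $\delta$ is a region of $[0,1]^2$ on which $\delta$ is constant. Boundary points are disregarded when identifying a plateau with a region bounded by a curve (the regions of constant depth are in general neither open nor closed): an open region is identified as a plateau if it is a connected component of the interior, relative to $[0,1]^2$, of a level set $\{\delta=k\}$. Interiors. For $m\ge2$, $E[p,m]$ is an ellipse and its interior is the bounded region it encloses. The interior of the parabola $E[1,1]$ is its convex side $\{(x-y)^2+1<2(x+y)\}$.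 For the degenerate case $E[0,1]$ (the line $x=0$) the interior is the half-plane $\{x<0\}$. Stern–Brocot tree. Start with the sequence of pairs $[1,0],[0,1]$ and repeatedly produce a new sequence by inserting between each two neighbors $[a,b],[c,d]$ the pair $[a+c,b+d]$. The pairs newly inserted at the $k$-th insertion step ($k=1,2,3,\dots$) form row $k$ of the tree. Thus row 1 is $\{[1,1]\}$, row 2 is $\{[2,1],[1,2]\}$, row 3 is $\{[3,1],[3,2],[2,3],[1,3]\}$, and so on; every pair of coprime positive integers occurs in exactly one row. *)

theory Defs
  imports "HOL-Analysis.Analysis" "HOL-Library.Extended_Nat"
begin

section \<open>Apollonian depth\<close>

definition has_nonpos :: "real \<times> real \<times> real \<Rightarrow> bool" where
  "has_nonpos = (\<lambda>(a, b, c). a \<le> 0 \<or> b \<le> 0 \<or> c \<le> 0)"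

(* Ties for the greatest entry are broken by position; the other choices give a permutation
   of the same triple, so the depth does not depend on this. *)
definition apollonian_step :: "real \<times> real \<times> real \<Rightarrow> real \<times> real \<times> real" where
  "apollonian_step = (\<lambda>(a, b, c).
     let r = a + b + c - 2 * sqrt (a * b + b * c + c * a)
     in if b \<le> a \<and> c \<le> a then (r, b, c)
        else if c \<le> b then (a, r, c)
        else (a, b, r))"

(* Iterates past the first triple with a nonpositive entry are never inspected.
   The minimal index is 0 if the initial triple already has a nonpositive entry. *)
definition apollonian_depth :: "real \<times> real \<times> real \<Rightarrow> enat" where
  "apollonian_depth t =
     (if \<exists>d. has_nonpos ((apollonian_step ^^ d) t)
      then enat (LEAST d. has_nonpos ((apollonian_step ^^ d) t))
      else \<infinity>)"

definition reduced_depth :: "real \<times> real \<Rightarrow> enat" where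
  "reduced_depth = (\<lambda>(x, y). apollonian_depth (1, x, y))"

definition unit_square :: "(real \<times> real) set" where
  "unit_square = {0..1} \<times> {0..1}"

definition is_plateau :: "(real \<times> real) set \<Rightarrow> bool" where
  "is_plateau X \<longleftrightarrow>
     (\<exists>k. X \<in> components ((top_of_set unit_square) interior_of
                           {z \<in> unit_square. reduced_depth z = k}))"


section \<open>The curves\<close>

definition reduced_index :: "nat \<Rightarrow> nat \<Rightarrow> bool" where
  "reduced_index p m \<longleftrightarrow> 1 \<le> m \<and> p \<le> m \<and> coprime p m"

(* For a reduced index, p = 0 forces m = 1. *)
definition E_curve :: "nat \<Rightarrow> nat \<Rightarrow> (real \<times> real) set" where
  "E_curve p m =
     (if p = 0 then {(x, y). x = 0}
      else {(x, y).
        (real m / real p * x + ((real p)\<^sup>2 + (real m)\<^sup>2 - 1) / (real p * real m) * y)\<^sup>2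
          + (real p)\<^sup>2 / (real m)\<^sup>2
        = 4 * x * y + 2 * x + 2 * (((real m)\<^sup>2 - (real p)\<^sup>2 + 1) / (real m)\<^sup>2) * y})"

(* For m > 1 the curve is an ellipse, and the constant inside denotes the union of the bounded
   connected components of the complement. *)
definition E_interior :: "nat \<Rightarrow> nat \<Rightarrow> (real \<times> real) set" where
  "E_interior p m =
     (if p = 0 then {(x, y). x < 0}
      else if m = 1 then {(x, y). (x - y)\<^sup>2 + 1 < 2 * (x + y)}
      else inside (E_curve p m))"

definition x_axis :: "(real \<times> real) set" where
  "x_axis = {(x, y). y = 0}"

definition is_ellipse :: "(real \<times> real) set \<Rightarrow> bool" where
  "is_ellipse C \<longleftrightarrow> (\<exists>f c. linear f \<and> inj f \<and> C = (\<lambda>z. c + f z) ` sphere (0 :: real \<times> real) 1)"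


section \<open>Tangency\<close>

(* L is the limit of the secants of C through z.  As z is a limit point of C, there is at most
   one such line. *)
definition tangent_line_at :: "(real \<times> real) set \<Rightarrow> real \<times> real \<Rightarrow> (real \<times> real) set \<Rightarrow> bool" where
  "tangent_line_at C z L \<longleftrightarrow>
     z \<in> C \<and> z islimpt C \<and>
     (\<exists>v. v \<noteq> 0 \<and> L = range (\<lambda>t::real. z + t *\<^sub>R v)) \<and>
     ((\<lambda>w. infdist w L / dist w z) \<longlongrightarrow> 0) (at z within C)"

definition tangent_at :: "(real \<times> real) set \<Rightarrow> (real \<times> real) set \<Rightarrow> real \<times> real \<Rightarrow> bool" where
  "tangent_at C D z \<longleftrightarrow> (\<exists>L. tangent_line_at C z L \<and> tangent_line_at D z L)"

definition tangent :: "(real \<times> real) set \<Rightarrow> (real \<times> real) set \<Rightarrow> bool" where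
  "tangent C D \<longleftrightarrow> (\<exists>z. tangent_at C D z)"


section \<open>Stern--Brocot tree\<close>

definition unimodular :: "nat \<Rightarrow> nat \<Rightarrow> nat \<Rightarrow> nat \<Rightarrow> bool" where
  "unimodular p m q n \<longleftrightarrow>
     det (vector [vector [int p, int q], vector [int m, int n]] :: int^2^2) \<in> {1, -1}"

fun mediant :: "nat \<times> nat \<Rightarrow> nat \<times> nat \<Rightarrow> nat \<times> nat" where
  "mediant (a, b) (c, d) = (a + c, b + d)"

fun mediants :: "(nat \<times> nat) list \<Rightarrow> (nat \<times> nat) list" where
  "mediants (u # v # ws) = mediant u v # mediants (v # ws)"
| "mediants ws = []"

fun insert_mediants :: "(nat \<times> nat) list \<Rightarrow> (nat \<times> nat) list" where
  "insert_mediants (u # v # ws) = u # mediant u v # insert_mediants (v # ws)"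
| "insert_mediants ws = ws"

definition sb_sequence :: "nat \<Rightarrow> (nat \<times> nat) list" where
  "sb_sequence k = (insert_mediants ^^ k) [(1, 0), (0, 1)]"

(* Rows are numbered from 1; row 0 is empty. *)
fun sb_row :: "nat \<Rightarrow> (nat \<times> nat) set" where
  "sb_row 0 = {}"
| "sb_row (Suc k) = set (mediants (sb_sequence k))"

(* Meaningful for coprime positive p and m, which lie in exactly one row. *)
definition sb_row_number :: "nat \<Rightarrow> nat \<Rightarrow> nat" where
  "sb_row_number p m = (THE k. (p, m) \<in> sb_row k)"

end

theory Submission
  imports Defs
begin

text \<open>
  Put \<open>s = sqrt (a b + b c + c a)\<close>.  The positive definite form
  \<open>f(p, m) = p\<^sup>2 (a + c) - 2 p m s + m\<^sup>2 (b + c)\<close> has determinant \<open>c\<^sup>2\<close>, and its values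
  diminished by \<open>c\<close>, at coprime \<open>p, m\<close>, are the curvatures of the disks of the Apollonian packing
  that touch the disk of curvature \<open>c\<close>.  For \<open>(a, b, c) = (1, x, y)\<close> the interior of \<open>E[p, m]\<close> is
  the region in which the disk \<open>[p, m]\<close> has negative curvature, and \<open>E[p, m]\<close> is the locus
  \<open>f(p, m) = y\<close>.

  The Gram identity gives \<open>f(p, m) f(q, n) \<ge> (p n - q m)\<^sup>2 c\<^sup>2\<close>; so at most one of these disks has
  negative curvature, which makes the interiors disjoint.  If the determinant is \<open>\<plusminus>1\<close> and both values
  equal \<open>c\<close>, the two index vectors are orthogonal for the form, and this determines the contact
  point; a common normal vector there proves tangency.

  One step of the depth recursion, which replaces \<open>a\<close> or \<open>b\<close> by the curvature of \<open>[1, 1]\<close>, changes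
  the index \<open>[p, m]\<close> into \<open>[p, m - p]\<close> or \<open>[p - m, m]\<close>, just as one ascends the Stern--Brocot tree.
  As long as \<open>[1, 1]\<close> has positive curvature but \<open>[p, m]\<close> does not, \<open>c\<close> is not the greatest entry.
  Hence the depth in the interior of \<open>E[p, m]\<close> is the row number.  The same recursion, followed in a
  neighbourhood of a boundary point of depth \<open>k\<close>, shows that the points just outside have a
  different depth, so the interior is a whole component.
\<close>

section \<open>Curvatures and conics\<close>

text \<open>The curvature of the disk \<open>[p, m]\<close> among those touching the disk of curvature \<open>c\<close>; the
  indices \<open>[1, 0]\<close> and \<open>[0, 1]\<close> give \<open>a\<close> and \<open>b\<close>.\<close>

definition curvature :: "nat \<Rightarrow> nat \<Rightarrow> real \<times> real \<times> real \<Rightarrow> real" where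
  "curvature p m = (\<lambda>(a, b, c). (real p)\<^sup>2 * (a + c)
     - 2 * real p * real m * sqrt (a * b + b * c + c * a) + (real m)\<^sup>2 * (b + c) - c)"

text \<open>The Gram determinant of two vectors is the determinant of the form, here
  \<open>(a + c) * (b + c) - s\<^sup>2 = c\<^sup>2\<close>, times the squared determinant of the
  vectors.\<close>

lemma gram_identity:
  fixes a b c s p m q n :: real
  assumes "s\<^sup>2 = a * b + b * c + c * a"
  shows "(p\<^sup>2 * (a + c) - 2 * p * m * s + m\<^sup>2 * (b + c)) * (q\<^sup>2 * (a + c) - 2 * q * n * s + n\<^sup>2 * (b + c))
    = (p * q * (a + c) - (p * n + q * m) * s + m * n * (b + c))\<^sup>2 + (p * n - q * m)\<^sup>2 * c\<^sup>2"
  using assms by algebra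

lemma form_nonneg:
  fixes a b c s p m :: real
  assumes s: "s\<^sup>2 = a * b + b * c + c * a" and "0 < a + c"
  shows "0 \<le> p\<^sup>2 * (a + c) - 2 * p * m * s + m\<^sup>2 * (b + c)"
proof -
  have "(p\<^sup>2 * (a + c) - 2 * p * m * s + m\<^sup>2 * (b + c)) * (a + c) = ((a + c) * p - s * m)\<^sup>2 + (m * c)\<^sup>2"
    using s by algebra
  then have "0 \<le> (p\<^sup>2 * (a + c) - 2 * p * m * s + m\<^sup>2 * (b + c)) * (a + c)" by simp
  with assms(2) show ?thesis by (simp add: zero_le_mult_iff)
qed

lemma det_sq_ge_1:
  assumes "p * n \<noteq> q * (m :: nat)"
  shows "1 \<le> (real p * real n - real q * real m)\<^sup>2"
proof -
  have "int p * int n - int q * int m \<noteq> 0" using assms by (metis eq_iff_diff_eq_0 nat_int_comparison(1) of_nat_mult)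
  then have "1 \<le> (int p * int n - int q * int m)\<^sup>2" by (smt (verit) zero_less_power2)
  then have "real_of_int 1 \<le> real_of_int ((int p * int n - int q * int m)\<^sup>2)" by linarith
  then show ?thesis by simp
qed

text \<open>Nonpositive curvature puts the form values \<open>f\<close> and \<open>g\<close> between
  0 and \<open>c\<close>, so the Gram identity bounds the squared determinant by 1. If one curvature
  is negative, the bound is strict, and the integer determinant vanishes.\<close>

lemma det_bound:
  assumes "0 \<le> a * b + b * c + c * a" "0 < c" "0 < a + c"
    and "curvature p m (a, b, c) \<le> 0" "curvature q n (a, b, c) \<le> 0"
  shows "(real p * real n - real q * real m)\<^sup>2 \<le> 1"
    and "curvature p m (a, b, c) < 0 \<Longrightarrow> p * n = q * m"
proof -
  define s where "s = sqrt (a * b + b * c + c * a)"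
  have s: "s\<^sup>2 = a * b + b * c + c * a" using assms(1) by (simp add: s_def)
  define f where "f = (real p)\<^sup>2 * (a + c) - 2 * real p * real m * s + (real m)\<^sup>2 * (b + c)"
  define g where "g = (real q)\<^sup>2 * (a + c) - 2 * real q * real n * s + (real n)\<^sup>2 * (b + c)"
  have f0: "0 \<le> f" "0 \<le> g" using form_nonneg[OF s assms(3), of p m] form_nonneg[OF s assms(3), of q n] by (simp_all add: f_def g_def)
  have fc: "f \<le> c" "g \<le> c" using assms(4,5) by (auto simp: curvature_def f_def g_def s_def algebra_simps)
  have *: "(real p * real n - real q * real m)\<^sup>2 * c\<^sup>2 \<le> f * g"
    unfolding f_def g_def gram_identity[OF s] by simp
  have "f * g \<le> c * c" using f0 fc by (intro mult_mono) auto
  with * have "(real p * real n - real q * real m)\<^sup>2 * c\<^sup>2 \<le> 1 * c\<^sup>2" by (simp add: power2_eq_square)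
  with assms(2) show "(real p * real n - real q * real m)\<^sup>2 \<le> 1"
    by (metis mult_le_cancel_right_pos zero_less_power)
  assume "curvature p m (a, b, c) < 0"
  then have "f < c" by (auto simp: curvature_def f_def s_def algebra_simps)
  then have "f * g < c * c" using f0 fc assms(2) by (smt (verit) mult_left_mono mult_strict_right_mono)
  with * have "(real p * real n - real q * real m)\<^sup>2 * c\<^sup>2 < 1 * c\<^sup>2" by (simp add: power2_eq_square)
  with assms(2) have "(real p * real n - real q * real m)\<^sup>2 < 1"
    by (metis mult_less_cancel_right_pos zero_less_power)
  then show "p * n = q * m" using det_sq_ge_1 by (meson not_le)
qed

text \<open>The equation of \<open>E[p, m]\<close> multiplied by \<open>p\<^sup>2 m\<^sup>2\<close>, with the square completed so that the
  discriminant in \<open>x\<close> can be read off.\<close>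

definition conic :: "nat \<Rightarrow> nat \<Rightarrow> real \<times> real \<Rightarrow> real" where
  "conic p m = (\<lambda>(x, y). ((real m)\<^sup>2 * x + ((real m)\<^sup>2 - (real p)\<^sup>2 - 1) * y - (real p)\<^sup>2)\<^sup>2
     + 4 * (real p)\<^sup>2 * (((real m)\<^sup>2 - 1) * y\<^sup>2 - y))"

text \<open>A difference of squares: for the triple \<open>(1, x, y)\<close> the base of the first
  square is the curvature without its square root term, and the second square is the square of that
  term.\<close>

lemma conic_alt:
  "conic p m (x, y) = ((real p)\<^sup>2 + (real m)\<^sup>2 * x + ((real p)\<^sup>2 + (real m)\<^sup>2 - 1) * y)\<^sup>2
     - 4 * (real p)\<^sup>2 * (real m)\<^sup>2 * (x + y + x * y)"
  by (simp add: conic_def) algebra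

lemma E_curve_eq:
  assumes "1 \<le> p" "1 \<le> m"
  shows "E_curve p m = {z. conic p m z = 0}"
proof -
  have "(real m / real p * x + ((real p)\<^sup>2 + (real m)\<^sup>2 - 1) / (real p * real m) * y)\<^sup>2
          + (real p)\<^sup>2 / (real m)\<^sup>2
        - (4 * x * y + 2 * x + 2 * (((real m)\<^sup>2 - (real p)\<^sup>2 + 1) / (real m)\<^sup>2) * y)
      = conic p m (x, y) / ((real p)\<^sup>2 * (real m)\<^sup>2)" for x y
    unfolding conic_alt using assms by (simp add: divide_simps) algebra
  then have *: "(real m / real p * x + ((real p)\<^sup>2 + (real m)\<^sup>2 - 1) / (real p * real m) * y)\<^sup>2
          + (real p)\<^sup>2 / (real m)\<^sup>2
        = 4 * x * y + 2 * x + 2 * (((real m)\<^sup>2 - (real p)\<^sup>2 + 1) / (real m)\<^sup>2) * y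
      \<longleftrightarrow> conic p m (x, y) / ((real p)\<^sup>2 * (real m)\<^sup>2) = 0" for x y
    by (metis eq_iff_diff_eq_0)
  have "(0 < real p) \<and> (0 < real m)" using assms by simp
  then show ?thesis unfolding E_curve_def using assms * by auto
qed

lemma E_curve_1_1: "E_curve 1 1 = {(x, y). 2 * (x + y) = (x - y)\<^sup>2 + 1}"
  by (subst E_curve_eq) (auto simp: conic_def power2_eq_square algebra_simps)

text \<open>Here \<open>conic\<close> is \<open>(F - M) * (F + M)\<close>, the curvature is
  \<open>F - M\<close>, and \<open>F + M\<close> is positive in the open quadrant.\<close>

lemma curvature_pos_iff:
  assumes "0 < x" "0 < y" "1 \<le> m"
  shows "0 < curvature p m (1, x, y) \<longleftrightarrow> 0 < conic p m (x, y)"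
    and "curvature p m (1, x, y) = 0 \<longleftrightarrow> conic p m (x, y) = 0"
proof -
  define F where "F = (real p)\<^sup>2 + (real m)\<^sup>2 * x + ((real p)\<^sup>2 + (real m)\<^sup>2 - 1) * y"
  define M where "M = 2 * real p * real m * sqrt (x + y + x * y)"
  have m: "1 \<le> (real m)\<^sup>2" using assms(3) by simp
  have "0 < (real m)\<^sup>2 * x" using assms by simp
  moreover have "0 \<le> ((real p)\<^sup>2 + (real m)\<^sup>2 - 1) * y"
    using m assms(2) by (intro mult_nonneg_nonneg) (auto intro: order_trans[OF m])
  ultimately have F: "0 < F" unfolding F_def by (smt (verit) zero_le_power2)
  have M: "0 \<le> M" using assms by (simp add: M_def)
  have "0 \<le> x + y + x * y" using assms by simp
  then have c: "conic p m (x, y) = F\<^sup>2 - M\<^sup>2" by (simp add: conic_alt F_def M_def power_mult_distrib)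
  have g: "curvature p m (1, x, y) = F - M" by (simp add: curvature_def F_def M_def algebra_simps)
  have "M < F \<longleftrightarrow> M\<^sup>2 < F\<^sup>2" using F M by (metis less_imp_le power_mono_iff not_le zero_less_numeral)
  then show "0 < curvature p m (1, x, y) \<longleftrightarrow> 0 < conic p m (x, y)" unfolding c g by simp
  have "F = M \<longleftrightarrow> F\<^sup>2 = M\<^sup>2" using F M by (metis less_imp_le power2_eq_imp_eq)
  then show "curvature p m (1, x, y) = 0 \<longleftrightarrow> conic p m (x, y) = 0" unfolding c g by simp
qed

text \<open>Positivity of \<open>y\<close> comes from the completed square. The difference of
  squares bounds \<open>F\<close> from above whatever its sign, so the curvature is negative in the
  whole region.\<close>

lemma conic_neg_imp:
  assumes "conic p m (x, y) < 0" "1 \<le> p" "1 \<le> m"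
  shows "0 < y" "((real m)\<^sup>2 - 1) * y < 1" "0 < x + y + x * y" "curvature p m (1, x, y) < 0"
proof -
  have "4 * (real p)\<^sup>2 * (((real m)\<^sup>2 - 1) * y\<^sup>2 - y) < 0"
    using assms(1) unfolding conic_def by (smt (verit) case_prod_conv zero_le_power2)
  then have *: "((real m)\<^sup>2 - 1) * y\<^sup>2 < y" using assms(2) by (simp add: mult_less_0_iff)
  have m: "1 \<le> (real m)\<^sup>2" using assms(3) by simp
  then have "0 \<le> ((real m)\<^sup>2 - 1) * y\<^sup>2" by simp
  with * show y: "0 < y" by linarith
  from * have "((real m)\<^sup>2 - 1) * y * y < 1 * y" by (simp add: power2_eq_square)
  with y show "((real m)\<^sup>2 - 1) * y < 1" by (metis mult_less_cancel_right_pos)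
  define F where "F = (real p)\<^sup>2 + (real m)\<^sup>2 * x + ((real p)\<^sup>2 + (real m)\<^sup>2 - 1) * y"
  have F: "F\<^sup>2 < 4 * (real p)\<^sup>2 * (real m)\<^sup>2 * (x + y + x * y)"
    using assms(1) unfolding conic_alt F_def by simp
  then have "0 < 4 * (real p)\<^sup>2 * (real m)\<^sup>2 * (x + y + x * y)" by (smt (verit) zero_le_power2)
  then have "0 < (4 * (real p)\<^sup>2 * (real m)\<^sup>2) * (x + y + x * y)" .
  then show q: "0 < x + y + x * y" by (rule zero_less_mult_pos) (use assms in simp)
  define s where "s = sqrt (x + y + x * y)"
  have s: "s\<^sup>2 = x + y + x * y" "0 \<le> s" using q by (auto simp: s_def)
  have "F\<^sup>2 < (2 * real p * real m * s)\<^sup>2" using F unfolding power_mult_distrib s(1) by simp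
  then have "F < 2 * real p * real m * s" by (rule power2_less_imp_less) (use s in simp)
  moreover have "curvature p m (1, x, y) = F - 2 * real p * real m * s"
    by (simp add: curvature_def F_def s_def algebra_simps)
  ultimately show "curvature p m (1, x, y) < 0" by simp
qed

text \<open>Squaring could have added a branch on which \<open>F\<close> is minus the square root
  term. It is excluded by \<open>0 \<le> F\<close>: the completed square gives
  \<open>\<bar>X\<bar> \<le> 2 * p\<^sup>2 * (1 + y)\<close>, and \<open>F\<close> is
  \<open>X\<close> plus this bound.\<close>

lemma conic_zero_imp:
  assumes "conic p m (x, y) = 0" "1 \<le> p" "1 \<le> m"
  shows "0 \<le> y" "0 \<le> x + y + x * y" "curvature p m (1, x, y) = 0"
proof -
  define X where "X = (real m)\<^sup>2 * x + ((real m)\<^sup>2 - (real p)\<^sup>2 - 1) * y - (real p)\<^sup>2"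
  have X: "X\<^sup>2 = 4 * (real p)\<^sup>2 * (y - ((real m)\<^sup>2 - 1) * y\<^sup>2)"
    using assms(1) by (simp add: conic_def X_def algebra_simps)
  then have "0 \<le> 4 * (real p)\<^sup>2 * (y - ((real m)\<^sup>2 - 1) * y\<^sup>2)" by (metis zero_le_power2)
  then have *: "((real m)\<^sup>2 - 1) * y\<^sup>2 \<le> y" using assms(2) by (simp add: zero_le_mult_iff)
  have m: "1 \<le> (real m)\<^sup>2" using assms(3) by simp
  then have my: "0 \<le> ((real m)\<^sup>2 - 1) * y\<^sup>2" by simp
  with * show y: "0 \<le> y" by linarith
  define F where "F = (real p)\<^sup>2 + (real m)\<^sup>2 * x + ((real p)\<^sup>2 + (real m)\<^sup>2 - 1) * y"
  have F: "F\<^sup>2 = 4 * (real p)\<^sup>2 * (real m)\<^sup>2 * (x + y + x * y)"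
    using assms(1) unfolding conic_alt F_def by simp
  then have "0 \<le> 4 * (real p)\<^sup>2 * (real m)\<^sup>2 * (x + y + x * y)" by (metis zero_le_power2)
  moreover have "0 < 4 * (real p)\<^sup>2 * (real m)\<^sup>2" using assms(2,3) by simp
  ultimately show q: "0 \<le> x + y + x * y" by (metis zero_le_mult_iff not_le)
  define s where "s = sqrt (x + y + x * y)"
  have s: "s\<^sup>2 = x + y + x * y" "0 \<le> s" using q by (auto simp: s_def)
  have F2: "F\<^sup>2 = (2 * real p * real m * s)\<^sup>2" using F unfolding power_mult_distrib s(1) by simp
  have p: "1 \<le> (real p)\<^sup>2" using assms(2) by simp
  have "X\<^sup>2 \<le> 4 * (real p)\<^sup>2 * y" unfolding X using my by (intro mult_left_mono) auto
  also have "\<dots> \<le> 4 * (real p)\<^sup>2 * ((real p)\<^sup>2 * (1 + y)\<^sup>2)"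
  proof (intro mult_left_mono)
    have "y \<le> (1 + y)\<^sup>2" using y by (simp add: power2_eq_square algebra_simps)
    also have "\<dots> \<le> (real p)\<^sup>2 * (1 + y)\<^sup>2" using p by (simp add: mult_le_cancel_right1)
    finally show "y \<le> (real p)\<^sup>2 * (1 + y)\<^sup>2" .
  qed auto
  also have "\<dots> = (2 * (real p)\<^sup>2 * (1 + y))\<^sup>2" by (simp add: power2_eq_square algebra_simps)
  finally have "\<bar>X\<bar> \<le> 2 * (real p)\<^sup>2 * (1 + y)"
    by (metis abs_le_square_iff abs_of_nonneg mult_nonneg_nonneg y add_nonneg_nonneg zero_le_one zero_le_numeral zero_le_power2)
  moreover have "F = X + 2 * (real p)\<^sup>2 * (1 + y)" by (simp add: F_def X_def algebra_simps)
  ultimately have "0 \<le> F" by linarith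
  then have "F = 2 * real p * real m * s" by (rule power2_eq_imp_eq[OF F2]) (use s in simp)
  moreover have "curvature p m (1, x, y) = F - 2 * real p * real m * s"
    by (simp add: curvature_def F_def s_def algebra_simps)
  ultimately show "curvature p m (1, x, y) = 0" by simp
qed

section \<open>Ellipses as affine images of the unit circle\<close>

text \<open>For \<open>m \<ge> 2\<close> the coefficient \<open>M = m\<^sup>2 - 1\<close> of the
  second quadratic term is positive, so completing the square in \<open>y\<close> as well turns
  \<open>conic\<close> into a multiple of \<open>(norm z)\<^sup>2 - 1\<close>.\<close>

lemma conic_parametrization:
  assumes "1 \<le> p" "2 \<le> m"
  obtains f :: "real \<times> real \<Rightarrow> real \<times> real" and c k where "linear f" "bij f" "0 < k"
    "\<And>z. conic p m (c + f z) = k * ((norm z)\<^sup>2 - 1)"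
proof -
  define M where "M = (real m)\<^sup>2 - 1"
  have "2\<^sup>2 \<le> (real m)\<^sup>2" using assms(2) by (intro power_mono) auto
  then have M: "0 < M" by (simp add: M_def)
  define r where "r = sqrt M"
  have r: "0 < r" "r\<^sup>2 = M" using M by (auto simp: r_def)
  define l where "l = M - (real p)\<^sup>2"
  \<comment> \<open>Solving \<open>m\<^sup>2 * x + l * y - p\<^sup>2 = p / r * s\<close> and
    \<open>y = (1 + t) / (2 * M)\<close> for \<open>(x, y)\<close> gives the linear part
    \<open>f\<close> and the centre \<open>c\<close>.\<close>
  define f where "f = (\<lambda>z. ((p / r * fst z - l / (2 * M) * snd z) / (real m)\<^sup>2, snd z / (2 * M)))"
  define c where "c = (((real p)\<^sup>2 - l / (2 * M)) / (real m)\<^sup>2, 1 / (2 * M))"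
  have pm: "0 < real p" "0 < real m" using assms by auto
  have "linear f" unfolding f_def by (intro linearI) (simp_all add: algebra_simps add_divide_distrib diff_divide_distrib)
  moreover have "bij f"
  proof -
    have "inj f"
    proof (rule injI)
      fix z w assume "f z = f w"
      then have s: "snd z = snd w" and
        "(p / r * fst z - l / (2 * M) * snd z) / (real m)\<^sup>2 = (p / r * fst w - l / (2 * M) * snd w) / (real m)\<^sup>2"
        using M by (auto simp: f_def)
      then have "p / r * fst z = p / r * fst w" using pm by simp
      then show "z = w" using s pm r(1) by (simp add: prod_eq_iff)
    qed
    then show ?thesis using \<open>linear f\<close> by (simp add: linear_injective_imp_surjective bij_def)
  qed
  moreover have "0 < (real p)\<^sup>2 / M" using pm M by simp
  moreover have "conic p m (c + f z) = (real p)\<^sup>2 / M * ((norm z)\<^sup>2 - 1)" for z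
  proof (cases z)
    case (Pair s t)
    have n: "(norm z)\<^sup>2 = s\<^sup>2 + t\<^sup>2" by (simp add: Pair norm_Pair)
    define y where "y = (1 + t) / (2 * M)"
    have cf: "c + f z = (((real p)\<^sup>2 + p / r * s - l * y) / (real m)\<^sup>2, y)"
      by (simp add: c_def f_def Pair y_def algebra_simps add_divide_distrib diff_divide_distrib)
    have l: "(real m)\<^sup>2 - (real p)\<^sup>2 - 1 = l" by (simp add: l_def M_def)
    have "(real m)\<^sup>2 * (u / (real m)\<^sup>2) = u" for u using pm by simp
    then have "conic p m (c + f z) = (p / r * s)\<^sup>2 + 4 * (real p)\<^sup>2 * (M * y\<^sup>2 - y)"
      unfolding cf conic_def case_prod_conv l by (simp add: M_def)
    also have "(p / r * s)\<^sup>2 = (real p)\<^sup>2 * s\<^sup>2 / M" using r by (simp add: power_mult_distrib power_divide)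
    also have "M * y\<^sup>2 - y = (t\<^sup>2 - 1) / (4 * M)"
      unfolding y_def using M by (simp add: field_simps power2_eq_square)
    finally show ?thesis unfolding n using M by (simp add: field_simps)
  qed
  ultimately show ?thesis using that by blast
qed

lemma affine_sublevel_images:
  fixes f :: "real \<times> real \<Rightarrow> real \<times> real" and k :: real
  assumes "bij f" "0 < k" and q: "\<And>z. q (c + f z) = k * ((norm z)\<^sup>2 - 1)"
  shows "{z. q z = 0} = (\<lambda>z. c + f z) ` sphere 0 1"
    and "{z. q z < 0} = (\<lambda>z. c + f z) ` ball 0 1"
    and "{z. q z \<le> 0} = (\<lambda>z. c + f z) ` cball 0 1"
proof -
  define h where "h z = c + f z" for z
  have surj: "\<exists>z. w = h z" for w
    using assms(1) by (metis h_def add.commute bij_pointE diff_add_cancel)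
  have img: "{w. P w} = h ` A" if "\<And>z. P (h z) \<longleftrightarrow> z \<in> A" for P A
    using that surj by fastforce
  have n: "(norm z)\<^sup>2 = 1 \<longleftrightarrow> norm z = 1" "(norm z)\<^sup>2 < 1 \<longleftrightarrow> norm z < 1" "(norm z)\<^sup>2 \<le> 1 \<longleftrightarrow> norm z \<le> 1"
    for z :: "real \<times> real"
    using abs_square_eq_1[of "norm z"] abs_square_less_1[of "norm z"] abs_square_le_1[of "norm z"] by simp_all
  show "{z. q z = 0} = (\<lambda>z. c + f z) ` sphere 0 1"
    unfolding h_def[symmetric] using assms(2) n(1) by (intro img) (simp add: h_def q)
  show "{z. q z < 0} = (\<lambda>z. c + f z) ` ball 0 1"
    unfolding h_def[symmetric] using assms(2) n(2) by (intro img) (simp add: h_def q mult_less_0_iff)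
  show "{z. q z \<le> 0} = (\<lambda>z. c + f z) ` cball 0 1"
    unfolding h_def[symmetric] using assms(2) n(3) by (intro img) (simp add: h_def q mult_le_0_iff)
qed

lemma is_ellipse_E_curve:
  assumes "1 \<le> p" "2 \<le> m"
  shows "is_ellipse (E_curve p m)"
proof -
  obtain f :: "real \<times> real \<Rightarrow> real \<times> real" and c k where f: "linear f" "bij f" "0 < k" "\<And>z. conic p m (c + f z) = k * ((norm z)\<^sup>2 - 1)"
    using conic_parametrization[OF assms] by metis
  have "E_curve p m = (\<lambda>z. c + f z) ` sphere 0 1"
    using affine_sublevel_images(1)[OF f(2-4)] assms by (simp add: E_curve_eq)
  then show ?thesis unfolding is_ellipse_def using f(1,2) by (meson bij_is_inj)
qed

text \<open>The case \<open>m = 1\<close> is the inequality for the parabola, hence the condition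
  \<open>p = 1\<close>. Otherwise the curve is the frontier of the compact convex set
  \<open>S\<close>, and the inside of such a frontier is the interior of the set.\<close>

lemma E_interior_eq:
  assumes "1 \<le> p" "1 \<le> m" "m = 1 \<Longrightarrow> p = 1"
  shows "E_interior p m = {z. conic p m z < 0}"
proof (cases "m = 1")
  case True
  then show ?thesis using assms by (auto simp: E_interior_def conic_def power2_eq_square algebra_simps)
next
  case False
  then have m: "2 \<le> m" using assms(2) by simp
  obtain f :: "real \<times> real \<Rightarrow> real \<times> real" and c k where f: "linear f" "bij f" "0 < k" "\<And>z. conic p m (c + f z) = k * ((norm z)\<^sup>2 - 1)"
    using conic_parametrization[OF assms(1) m] by metis
  note im = affine_sublevel_images[OF f(2-4)]
  define S where "S = {z. conic p m z \<le> 0}"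
  have S: "S = (+) c ` f ` cball 0 1" by (simp add: S_def im(3) image_image)
  have "compact S" unfolding S using f(1)
    by (intro compact_translation compact_continuous_image compact_cball linear_continuous_on)
      (simp add: linear_conv_bounded_linear)
  have "convex S" unfolding S using f(1) by (intro convex_translation convex_linear_image convex_cball)
  have int: "interior S = {z. conic p m z < 0}"
    unfolding S interior_translation interior_injective_linear_image[OF f(1) bij_is_inj[OF f(2)]] interior_cball
    by (simp add: im(2) image_image)
  have "frontier S = S - interior S"
    using \<open>compact S\<close> by (simp add: frontier_def compact_imp_closed)
  also have "\<dots> = E_curve p m" unfolding int unfolding S_def using assms by (auto simp: E_curve_eq)
  finally have "frontier S = E_curve p m" .
  then have "inside (E_curve p m) = interior S"
    using inside_frontier_eq_interior[OF compact_imp_bounded[OF \<open>compact S\<close>] \<open>convex S\<close>] by simp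
  then show ?thesis using False assms by (simp add: E_interior_def int)
qed

section \<open>Tangent lines and limit points\<close>

text \<open>The distance from \<open>w\<close> to the line with normal \<open>g\<close> is at most
  \<open>\<bar>g \<bullet> (w - z)\<bar> / norm g\<close>. If this is quadratic in
  \<open>dist w z\<close>, the quotient in the definition of the tangent line tends to 0.\<close>

lemma tangent_line_at_quadratic:
  fixes g z :: "real \<times> real"
  assumes "z \<in> C" "z islimpt C" "g \<noteq> 0"
    and K: "\<And>w. w \<in> C \<Longrightarrow> \<bar>g \<bullet> (w - z)\<bar> \<le> K * (dist w z)\<^sup>2"
  shows "tangent_line_at C z {w. g \<bullet> (w - z) = 0}"
proof -
  define L where "L = {w. g \<bullet> (w - z) = 0}"
  define v where "v = (- snd g, fst g)"
  have "v \<noteq> 0" using assms(3) by (auto simp: v_def prod_eq_iff)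
  have gg: "g \<bullet> g = (fst g)\<^sup>2 + (snd g)\<^sup>2" "0 < g \<bullet> g"
    subgoal by (simp add: inner_prod_def power2_eq_square)
    subgoal using assms(3) by (simp only: inner_gt_zero_iff) simp
    done
  have line: "L = range (\<lambda>t. z + t *\<^sub>R v)"
  proof (intro equalityI subsetI)
    fix w assume "w \<in> L"
    then have o: "fst g * (fst w - fst z) + snd g * (snd w - snd z) = 0" by (simp add: L_def inner_prod_def)
    \<comment> \<open>The coordinate of \<open>w - z\<close> along \<open>v\<close>, which is
      \<open>g\<close> after a quarter turn and has the same length.\<close>
    define t where "t = ((snd w - snd z) * fst g - (fst w - fst z) * snd g) / (g \<bullet> g)"
    have "t * (g \<bullet> g) = (snd w - snd z) * fst g - (fst w - fst z) * snd g" using gg(2) by (simp add: t_def)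
    then have "(fst w - (fst z - t * snd g)) * (g \<bullet> g) = 0" "(snd w - (snd z + t * fst g)) * (g \<bullet> g) = 0"
      using o unfolding gg(1) by algebra+
    then have "w = z + t *\<^sub>R v" using gg(2) by (auto simp: v_def prod_eq_iff)
    then show "w \<in> range (\<lambda>t. z + t *\<^sub>R v)" by blast
  next
    fix w assume "w \<in> range (\<lambda>t. z + t *\<^sub>R v)"
    then show "w \<in> L" by (auto simp: L_def v_def inner_prod_def)
  qed
  have dist_le: "infdist w L \<le> \<bar>g \<bullet> (w - z)\<bar> / norm g" for w
  proof -
    \<comment> \<open>The foot of the perpendicular from \<open>w\<close> to
      \<open>L\<close>.\<close>
    define u where "u = w - ((g \<bullet> (w - z)) / (g \<bullet> g)) *\<^sub>R g"
    have "u \<in> L" using gg(2) by (simp add: L_def u_def inner_diff_right)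
    then have "infdist w L \<le> dist w u" by (rule infdist_le)
    also have "\<dots> = \<bar>g \<bullet> (w - z)\<bar> / norm g"
      using gg(2) by (simp add: u_def dist_norm dot_square_norm power2_eq_square)
    finally show ?thesis .
  qed
  have g: "0 < norm g" using assms(3) by simp
  have "((\<lambda>w. infdist w L / dist w z) \<longlongrightarrow> 0) (at z within C)"
  proof (rule Lim_null_comparison)
    have "norm (infdist w L / dist w z) \<le> K / norm g * dist w z" if "w \<in> C" "w \<noteq> z" for w
    proof -
      have "infdist w L \<le> K * (dist w z)\<^sup>2 / norm g"
        using dist_le[of w] K[OF that(1)] g by (meson divide_right_mono order_trans less_imp_le)
      then have "infdist w L / dist w z \<le> K * (dist w z)\<^sup>2 / norm g / dist w z" by (rule divide_right_mono) simp
      also have "\<dots> = K / norm g * dist w z" using that(2) by (simp add: power2_eq_square)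
      finally show ?thesis by (simp add: infdist_nonneg)
    qed
    then show "\<forall>\<^sub>F w in at z within C. norm (infdist w L / dist w z) \<le> K / norm g * dist w z"
      by (auto simp: eventually_at intro: exI[of _ 1])
    have "((\<lambda>w. K / norm g * dist w z) \<longlongrightarrow> K / norm g * dist z z) (at z within C)"
      by (intro tendsto_intros)
    then show "((\<lambda>w. K / norm g * dist w z) \<longlongrightarrow> 0) (at z within C)" by simp
  qed
  then show ?thesis
    unfolding tangent_line_at_def L_def[symmetric] using assms(1,2) line \<open>v \<noteq> 0\<close> by metis
qed

lemma islimpt_connected:
  assumes "connected C" "z \<in> C" "w \<in> C" "w \<noteq> z"
  shows "z islimpt (C :: (real \<times> real) set)"
  using assms connected_imp_perfect by (metis singletonD)

text \<open>Each curve is a continuous image of a line or a circle and has two points, so it is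
  connected and has no isolated point. The conditions leave the line \<open>[0, 1]\<close>, the
  parabola \<open>[1, 1]\<close> and the ellipses.\<close>

lemma islimpt_E_curve:
  assumes "1 \<le> m" "m = 1 \<Longrightarrow> p \<le> 1" "p = 0 \<Longrightarrow> m = 1" "z \<in> E_curve p m"
  shows "z islimpt E_curve p m"
proof -
  have "connected (E_curve p m) \<and> (\<exists>u v. u \<noteq> v \<and> u \<in> E_curve p m \<and> v \<in> E_curve p m)" (is "_ \<and> ?two")
  proof (cases "m = 1")
    case m: True
    show ?thesis
    proof (cases "p = 0")
      case True
      then have E: "E_curve p m = (\<lambda>t. (0, t)) ` UNIV" by (auto simp: E_curve_def)
      have "connected (E_curve p m)" unfolding E
        by (intro connected_continuous_image continuous_intros connected_UNIV)
      moreover have ?two unfolding E by (intro exI[of _ "(0, 0)"] exI[of _ "(0, 1)"]) auto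
      ultimately show ?thesis ..
    next
      case False
      then have p: "p = 1" using assms(2) m by simp
      \<comment> \<open>On this parametrization \<open>x - y = t + 1\<close>, so the parameter of a
        point is \<open>x - y - 1\<close>.\<close>
      have E: "E_curve p m = (\<lambda>t. ((t + 2)\<^sup>2 / 4, t\<^sup>2 / 4)) ` UNIV"
      proof (intro equalityI subsetI)
        fix w assume "w \<in> E_curve p m"
        then obtain x y where w: "w = (x, y)" and "2 * (x + y) = (x - y)\<^sup>2 + 1"
          using E_curve_1_1 m p by auto
        then have "x = (x - y - 1 + 2)\<^sup>2 / 4" "y = (x - y - 1)\<^sup>2 / 4"
            by (auto simp: power2_eq_square algebra_simps)
        then show "w \<in> (\<lambda>t. ((t + 2)\<^sup>2 / 4, t\<^sup>2 / 4)) ` UNIV" unfolding w by (intro image_eqI[of _ _ "x - y - 1"]) simp_all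
      next
        fix w assume "w \<in> range (\<lambda>t :: real. ((t + 2)\<^sup>2 / 4, t\<^sup>2 / 4))"
        then obtain t where "w = ((t + 2)\<^sup>2 / 4, t\<^sup>2 / 4)" by blast
        moreover have "2 * ((t + 2)\<^sup>2 / 4 + t\<^sup>2 / 4) = ((t + 2)\<^sup>2 / 4 - t\<^sup>2 / 4)\<^sup>2 + 1"
          by (simp add: power2_eq_square field_simps)
        ultimately show "w \<in> E_curve p m" using E_curve_1_1 m p by auto
      qed
      have "connected (E_curve p m)" unfolding E
        by (intro connected_continuous_image continuous_intros connected_UNIV) auto
      moreover have ?two
        using E_curve_1_1 m p by (intro exI[of _ "(0, 1)"] exI[of _ "(1, 0)"]) auto
      ultimately show ?thesis ..
    qed
  next
    case False
    then have "p \<noteq> 0" using assms(3) by blast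
    then have m: "1 \<le> p" "2 \<le> m" using False assms(1) by auto
    obtain f :: "real \<times> real \<Rightarrow> real \<times> real" and c k where f: "linear f" "bij f" "0 < k" "\<And>z. conic p m (c + f z) = k * ((norm z)\<^sup>2 - 1)"
      using conic_parametrization[OF m] by metis
    have E: "E_curve p m = (\<lambda>z. c + f z) ` sphere 0 1"
      using affine_sublevel_images(1)[OF f(2-4)] m by (simp add: E_curve_eq)
    have "connected (E_curve p m)" unfolding E using f(1)
      by (intro connected_continuous_image continuous_intros linear_continuous_on connected_sphere)
        (auto simp: linear_conv_bounded_linear)
    moreover have "c + f (1, 0) \<in> E_curve p m" "c + f (-1, 0) \<in> E_curve p m"
      unfolding E by (rule imageI; simp add: norm_Pair)+
    moreover have "c + f (1, 0) \<noteq> c + f (-1, 0)" by (simp add: inj_eq[OF bij_is_inj[OF f(2)]])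
    ultimately show ?thesis by metis
  qed
  then show ?thesis using islimpt_connected assms(4) by metis
qed

definition conic_gradient :: "nat \<Rightarrow> nat \<Rightarrow> real \<times> real \<Rightarrow> real \<times> real" where
  "conic_gradient p m z =
    (let X = (real m)\<^sup>2 * fst z + ((real m)\<^sup>2 - (real p)\<^sup>2 - 1) * snd z - (real p)\<^sup>2
     in (2 * X * (real m)\<^sup>2,
         2 * X * ((real m)\<^sup>2 - (real p)\<^sup>2 - 1) + 4 * (real p)\<^sup>2 * (2 * ((real m)\<^sup>2 - 1) * snd z - 1)))"

text \<open>The second-order expansion of a quadratic polynomial is exact. Between two zeros the
  linear part is therefore minus the quadratic part, which \<open>K\<close> dominates through
  \<open>(u + v)\<^sup>2 \<le> 2 * u\<^sup>2 + 2 * v\<^sup>2\<close>.\<close>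

lemma conic_second_order:
  obtains K where "\<And>w z. conic p m w = 0 \<Longrightarrow> conic p m z = 0 \<Longrightarrow>
    \<bar>conic_gradient p m z \<bullet> (w - z)\<bar> \<le> K * (dist w z)\<^sup>2"
proof -
  define l where "l = (real m)\<^sup>2 - (real p)\<^sup>2 - 1"
  define M where "M = 4 * (real p)\<^sup>2 * ((real m)\<^sup>2 - 1)"
  define K where "K = 2 * ((real m)\<^sup>2)\<^sup>2 + 2 * l\<^sup>2 + \<bar>M\<bar>"
  show ?thesis
  proof (rule that[of K])
    fix w z :: "real \<times> real"
    assume w: "conic p m w = 0" and z: "conic p m z = 0"
    define X where "X = (real m)\<^sup>2 * fst z + l * snd z - (real p)\<^sup>2"
    define a b where "a = fst w - fst z" and "b = snd w - snd z"
    have d: "(dist w z)\<^sup>2 = a\<^sup>2 + b\<^sup>2"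
      by (cases w; cases z) (simp add: dist_Pair_Pair dist_real_def a_def b_def)
    have w': "(X + (real m)\<^sup>2 * a + l * b)\<^sup>2 + M * (snd z + b)\<^sup>2 - 4 * (real p)\<^sup>2 * (snd z + b) = 0"
      using w by (cases w) (simp add: conic_def X_def a_def b_def l_def M_def algebra_simps)
    have z': "X\<^sup>2 + M * (snd z)\<^sup>2 - 4 * (real p)\<^sup>2 * snd z = 0"
      using z by (cases z) (simp add: conic_def X_def l_def M_def algebra_simps)
    have "2 * X * (real m)\<^sup>2 * a + (2 * X * l + 2 * M * snd z - 4 * (real p)\<^sup>2) * b
      = - (((real m)\<^sup>2 * a + l * b)\<^sup>2 + M * b\<^sup>2)"
      using w' z' by algebra
    moreover have "\<bar>((real m)\<^sup>2 * a + l * b)\<^sup>2 + M * b\<^sup>2\<bar> \<le> K * (a\<^sup>2 + b\<^sup>2)"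
    proof -
      have "((real m)\<^sup>2 * a + l * b)\<^sup>2 \<le> 2 * ((real m)\<^sup>2 * a)\<^sup>2 + 2 * (l * b)\<^sup>2"
        using zero_le_power2[of "(real m)\<^sup>2 * a - l * b"] by (simp add: power2_eq_square algebra_simps)
      moreover have "\<bar>M * b\<^sup>2\<bar> = \<bar>M\<bar> * b\<^sup>2" by (simp add: abs_mult)
      moreover have "0 \<le> \<bar>M\<bar> * a\<^sup>2" "0 \<le> ((real m)\<^sup>2 * b)\<^sup>2" "0 \<le> (l * a)\<^sup>2" by auto
      moreover have "K * (a\<^sup>2 + b\<^sup>2) = 2 * ((real m)\<^sup>2 * a)\<^sup>2 + 2 * (l * b)\<^sup>2 + \<bar>M\<bar> * b\<^sup>2
        + (\<bar>M\<bar> * a\<^sup>2 + 2 * ((real m)\<^sup>2 * b)\<^sup>2 + 2 * (l * a)\<^sup>2)"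
        by (simp add: K_def power_mult_distrib algebra_simps)
      moreover have "0 \<le> ((real m)\<^sup>2 * a + l * b)\<^sup>2" by simp
      ultimately show ?thesis by linarith
    qed
    ultimately show "\<bar>conic_gradient p m z \<bullet> (w - z)\<bar> \<le> K * (dist w z)\<^sup>2"
      unfolding d by (simp add: conic_gradient_def Let_def inner_prod_def flip: l_def X_def a_def b_def)
        (simp add: M_def algebra_simps)
  qed
qed

section \<open>Tangency and disjointness\<close>

lemma reduced_indexD:
  assumes "reduced_index p m"
  shows "1 \<le> m" "p \<le> m" "m = 1 \<Longrightarrow> p \<le> 1" "p = 0 \<Longrightarrow> m = 1" "m = p \<Longrightarrow> p = 1"
  using assms by (auto simp: reduced_index_def)

text \<open>The factor \<open>k\<close> allows two conics with proportional gradients at a common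
  point to be given the same normal \<open>g\<close>.\<close>

lemma E_curve_tangent_line:
  assumes "reduced_index p m" "1 \<le> p" "z \<in> E_curve p m"
    and g: "conic_gradient p m z = k *\<^sub>R g" "k \<noteq> 0" "g \<noteq> 0"
  shows "tangent_line_at (E_curve p m) z {w. g \<bullet> (w - z) = 0}"
proof -
  note r = reduced_indexD[OF assms(1)]
  have E: "E_curve p m = {z. conic p m z = 0}" using assms(2) r(1) by (rule E_curve_eq)
  obtain K where K: "\<And>w z. conic p m w = 0 \<Longrightarrow> conic p m z = 0 \<Longrightarrow>
      \<bar>conic_gradient p m z \<bullet> (w - z)\<bar> \<le> K * (dist w z)\<^sup>2"
    using conic_second_order by blast
  have "tangent_line_at (E_curve p m) z {w. (k *\<^sub>R g) \<bullet> (w - z) = 0}"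
  proof (rule tangent_line_at_quadratic)
    show "z islimpt E_curve p m" using r assms(3) by (intro islimpt_E_curve)
    show "\<bar>(k *\<^sub>R g) \<bullet> (w - z)\<bar> \<le> K * (dist w z)\<^sup>2" if "w \<in> E_curve p m" for w
      using K[of w z] that assms(3) unfolding E g(1) by simp
  qed (use assms in auto)
  then show ?thesis using g(2) by simp
qed

text \<open>For the two straight curves, the x-axis and \<open>E_curve 0 1\<close>.\<close>

lemma tangent_line_at_affine:
  fixes g z :: "real \<times> real"
  assumes "z \<in> C" "z islimpt C" "g \<noteq> 0" "\<And>w. w \<in> C \<Longrightarrow> g \<bullet> (w - z) = 0"
  shows "tangent_line_at C z {w. g \<bullet> (w - z) = 0}"
  by (rule tangent_line_at_quadratic[where K = 0]) (use assms in auto)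

lemma E_curve_nonneg:
  assumes "1 \<le> p" "1 \<le> m"
  shows "E_curve p m \<subseteq> {(x, y). 0 \<le> y}"
  using conic_zero_imp(1)[OF _ assms] assms by (auto simp: E_curve_eq)

text \<open>On \<open>y = 0\<close> the polynomial \<open>conic\<close> is the square of
  \<open>m\<^sup>2 * x - p\<^sup>2\<close>, with a double root at the contact point.\<close>

lemma E_curve_x_axis:
  assumes "1 \<le> p" "1 \<le> m"
  shows "E_curve p m \<inter> x_axis = {((real p)\<^sup>2 / (real m)\<^sup>2, 0)}"
  using assms by (auto simp: E_curve_eq x_axis_def conic_def field_simps)

lemma tangent_at_x_axis:
  assumes "reduced_index p m" "1 \<le> p"
  shows "tangent_at (E_curve p m) x_axis ((real p)\<^sup>2 / (real m)\<^sup>2, 0)"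
proof -
  note r = reduced_indexD[OF assms(1)]
  define z where "z = ((real p)\<^sup>2 / (real m)\<^sup>2, 0 :: real)"
  have z: "z \<in> E_curve p m" "z \<in> x_axis" using E_curve_x_axis[OF assms(2) r(1)] by (auto simp: z_def)
  have "tangent_line_at (E_curve p m) z {w. (0, 1) \<bullet> (w - z) = 0}"
  proof (rule E_curve_tangent_line[OF assms z(1)])
    show "conic_gradient p m z = (- 4 * (real p)\<^sup>2) *\<^sub>R (0, 1)"
      using r(1) by (simp add: conic_gradient_def z_def Let_def)
  qed (use assms(2) in \<open>auto simp: prod_eq_iff\<close>)
  moreover have "tangent_line_at x_axis z {w. (0, 1) \<bullet> (w - z) = 0}"
  proof (rule tangent_line_at_affine)
    have E: "x_axis = (\<lambda>t. (t, 0)) ` UNIV" by (auto simp: x_axis_def)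
    have "connected x_axis" unfolding E
      by (intro connected_continuous_image continuous_intros connected_UNIV)
    moreover have "z + (1, 0) \<in> x_axis" by (auto simp: x_axis_def z_def)
    ultimately show "z islimpt x_axis" using z(2)
      by (rule_tac islimpt_connected[of _ _ "z + (1, 0)"]) (auto simp: prod_eq_iff)
  qed (use z in \<open>auto simp: x_axis_def z_def inner_prod_def prod_eq_iff\<close>)
  ultimately show ?thesis unfolding tangent_at_def z_def by blast
qed

section \<open>Unimodular pairs and their contact points\<close>

lemma unimodular_det:
  assumes "unimodular p m q n"
  shows "(real p * real n - real q * real m)\<^sup>2 = 1"
proof -
  have "int p * int n - int q * int m \<in> {1, -1}" using assms by (simp add: unimodular_def det_2)
  then have "(int p * int n - int q * int m)\<^sup>2 = 1" by auto
  then have "real_of_int ((int p * int n - int q * int m)\<^sup>2) = real_of_int 1" by (rule arg_cong)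
  then show ?thesis by simp
qed

lemma unimodular_sym: "unimodular p m q n \<Longrightarrow> unimodular q n p m"
  by (auto simp: unimodular_def det_2 algebra_simps)

lemma unimodular_pos: "unimodular p m q n \<Longrightarrow> 1 \<le> p \<or> 1 \<le> q"
  by (rule ccontr) (auto simp: unimodular_def det_2 not_le)

lemma unimodular_mediant: "unimodular p m q n \<Longrightarrow> unimodular (p + q) (m + n) q n"
  by (auto simp: unimodular_def det_2 algebra_simps)

lemma coprime_if_unimodular: "unimodular p m q n \<Longrightarrow> coprime p m"
proof -
  assume "unimodular p m q n"
  then have *: "int p * int n - int q * int m \<in> {1, -1}" by (simp add: unimodular_def det_2)
  have "coprime (int p) (int m)"
  proof (rule coprimeI)
    fix d assume "d dvd int p" "d dvd int m"
    then have "d dvd int p * int n - int q * int m" by simp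
    then show "is_unit d" using * by auto
  qed
  then show ?thesis by simp
qed

lemma reduced_index_mediant:
  assumes "reduced_index p m" "reduced_index q n" "unimodular p m q n"
  shows "reduced_index (p + q) (m + n)"
  using assms coprime_if_unimodular[OF unimodular_mediant[OF assms(3)]] by (auto simp: reduced_index_def)

definition contact_point :: "nat \<Rightarrow> nat \<Rightarrow> nat \<Rightarrow> nat \<Rightarrow> real \<times> real" where
  "contact_point p m q n = (((real p)\<^sup>2 + (real q)\<^sup>2 - 1) / ((real m)\<^sup>2 + (real n)\<^sup>2 - 1),
                 1 / ((real m)\<^sup>2 + (real n)\<^sup>2 - 1))"

text \<open>The gradient of the conic \<open>[p, m]\<close> at the contact point without its factor
  \<open>4 * p * m / (m\<^sup>2 + n\<^sup>2 - 1)\<close>. In this normalization exchanging the two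
  indices only changes the sign, and the case \<open>p = 0\<close> gives the normal of the line
  \<open>x = 0\<close>.\<close>

definition contact_normal :: "nat \<Rightarrow> nat \<Rightarrow> nat \<Rightarrow> nat \<Rightarrow> real \<times> real" where
  "contact_normal p m q n = (let D = real p * real n - real q * real m in
     (- (real m * real n * D), D * (real p * real q - real m * real n) - real q * real n + real p * real m))"

lemma contact_point_sym: "contact_point q n p m = contact_point p m q n"
  by (simp add: contact_point_def add.commute)

lemma contact_normal_sym: "contact_normal q n p m = - contact_normal p m q n"
  by (simp add: contact_normal_def Let_def algebra_simps)

text \<open>At the contact point the linear term \<open>X\<close> of the conic equals
  \<open>- 2 * D * p * n / T\<close>. With \<open>D\<^sup>2 = 1\<close> this makes
  \<open>conic\<close> vanish and the gradient a multiple of \<open>contact_normal\<close>.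
  Exchanging the indices yields the other curve.\<close>

lemma tangent_line_at_contact_point:
  assumes "reduced_index p m" "reduced_index q n" "unimodular p m q n"
  defines "z \<equiv> contact_point p m q n"
  shows "z \<in> E_curve p m" (is ?in)
    and "tangent_line_at (E_curve p m) z {w. contact_normal p m q n \<bullet> (w - z) = 0}" (is ?tan)
proof -
  note r = reduced_indexD[OF assms(1)] reduced_indexD[OF assms(2)]
  define D where "D = real p * real n - real q * real m"
  have D: "D\<^sup>2 = 1" using unimodular_det[OF assms(3)] by (simp add: D_def)
  define T where "T = (real m)\<^sup>2 + (real n)\<^sup>2 - 1"
  have "1 \<le> (real m)\<^sup>2" "1 \<le> (real n)\<^sup>2" using r by auto
  then have T: "0 < T" by (simp add: T_def)
  have z: "z = (((real p)\<^sup>2 + (real q)\<^sup>2 - 1) / T, 1 / T)" by (simp add: z_def contact_point_def T_def)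
  have "D \<noteq> 0" using D by auto
  then have N: "contact_normal p m q n \<noteq> 0" using r by (auto simp: contact_normal_def Let_def prod_eq_iff D_def)
  have "?in \<and> ?tan"
  proof (cases "p = 0")
    case True
    then have m: "m = 1" and "(real q)\<^sup>2 = 1" using r(4) D by (auto simp: D_def)
    then have q: "q = 1" by (simp add: power2_eq_1_iff)
    have ?in using True q by (simp add: E_curve_def z)
    moreover have ?tan
    proof (rule tangent_line_at_affine[OF calculation _ N])
      show "z islimpt E_curve p m" using r calculation by (intro islimpt_E_curve)
      show "contact_normal p m q n \<bullet> (w - z) = 0" if "w \<in> E_curve p m" for w
        using that True q m by (auto simp: E_curve_def z contact_normal_def Let_def)
    qed
    ultimately show ?thesis ..
  next
    case False
    then have p: "1 \<le> p" by simp
    define X where "X = (real m)\<^sup>2 * fst z + ((real m)\<^sup>2 - (real p)\<^sup>2 - 1) * snd z - (real p)\<^sup>2"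
    have "(real m)\<^sup>2 * ((real p)\<^sup>2 + (real q)\<^sup>2 - 1) + ((real m)\<^sup>2 - (real p)\<^sup>2 - 1) - (real p)\<^sup>2 * T = - 2 * D * real p * real n"
      using D unfolding T_def D_def by algebra
    moreover have "X = ((real m)\<^sup>2 * ((real p)\<^sup>2 + (real q)\<^sup>2 - 1) + ((real m)\<^sup>2 - (real p)\<^sup>2 - 1) - (real p)\<^sup>2 * T) / T"
      using T by (simp add: X_def z field_simps)
    ultimately have X: "X = - 2 * D * real p * real n / T" by simp
    have "conic p m z = X\<^sup>2 + 4 * (real p)\<^sup>2 * (((real m)\<^sup>2 - 1) * (1 / T)\<^sup>2 - 1 / T)"
      by (simp add: conic_def X_def z)
    also have "\<dots> = 4 * (real p)\<^sup>2 * (D\<^sup>2 * (real n)\<^sup>2 + (real m)\<^sup>2 - 1 - T) / T\<^sup>2"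
      unfolding X using T by (simp add: field_simps power2_eq_square)
    also have "\<dots> = 0" unfolding D T_def by simp
    finally have "?in" using E_curve_eq[OF p r(1)] by simp
    moreover have ?tan
    proof (rule E_curve_tangent_line[OF assms(1) p calculation])
      \<comment> \<open>Exposes in the second component of the gradient the factor \<open>m\<close>
        that the first one carries visibly.\<close>
      have *: "- D * n * ((real m)\<^sup>2 - (real p)\<^sup>2 - 1) + real p * ((real m)\<^sup>2 - (real n)\<^sup>2 - 1)
          = real m * (D * (real p * real q - real m * real n) - real q * real n + real p * real m)"
        using D unfolding D_def by algebra
      have "2 * X * ((real m)\<^sup>2 - (real p)\<^sup>2 - 1) + 4 * (real p)\<^sup>2 * (2 * ((real m)\<^sup>2 - 1) * (1 / T) - 1)
         = 4 * real p / T * (- D * n * ((real m)\<^sup>2 - (real p)\<^sup>2 - 1) + real p * (2 * ((real m)\<^sup>2 - 1) - T))"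
        unfolding X using T by (simp add: field_simps power2_eq_square)
      also have "2 * ((real m)\<^sup>2 - 1) - T = (real m)\<^sup>2 - (real n)\<^sup>2 - 1" by (simp add: T_def)
      finally have "2 * X * ((real m)\<^sup>2 - (real p)\<^sup>2 - 1) + 4 * (real p)\<^sup>2 * (2 * ((real m)\<^sup>2 - 1) * (1 / T) - 1)
        = (4 * real p * real m / T) * (D * (real p * real q - real m * real n) - real q * real n + real p * real m)"
        unfolding * by simp
      moreover have "2 * X * (real m)\<^sup>2 = (4 * real p * real m / T) * - (real m * real n * D)"
        unfolding X by (simp add: power2_eq_square)
      ultimately show "conic_gradient p m z = (4 * real p * real m / T) *\<^sub>R contact_normal p m q n"
        unfolding conic_gradient_def contact_normal_def X_def[symmetric] D_def[symmetric] Let_def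
        by (simp add: z del: times_divide_eq_left)
      show "4 * real p * real m / T \<noteq> 0" using p r(1) T by simp
    qed (rule N)
    ultimately show ?thesis ..
  qed
  then show ?in ?tan by auto
qed

lemma tangent_at_contact_point:
  assumes "reduced_index p m" "reduced_index q n" "unimodular p m q n"
  shows "tangent_at (E_curve p m) (E_curve q n) (contact_point p m q n)"
  using tangent_line_at_contact_point(2)[OF assms]
    tangent_line_at_contact_point(2)[OF assms(2,1) unimodular_sym[OF assms(3)]]
  unfolding tangent_at_def contact_point_sym[of q n p m] contact_normal_sym[of q n p m]
  by (intro exI[of _ "{w. contact_normal p m q n \<bullet> (w - contact_point p m q n) = 0}"]) simp

lemma curvature_eq_0_on_E_curve:
  assumes "(x, y) \<in> E_curve p m" "reduced_index p m" "0 \<le> y"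
  shows "curvature p m (1, x, y) = 0"
proof (cases "p = 0")
  case True
  then show ?thesis using assms by (auto simp: E_curve_def curvature_def dest: reduced_indexD)
next
  case False
  then show ?thesis using assms conic_zero_imp(3)[of p m x y] reduced_indexD(1)[of p m] by (simp add: E_curve_eq)
qed

text \<open>At a common point both form values equal \<open>y\<close>. The Gram identity with
  determinant \<open>\<plusminus>1\<close> then forces the mixed term \<open>B\<close> to be 0, so
  the two index vectors form an orthogonal basis of known lengths, and this determines the whole
  form.\<close>

lemma E_curves_contact:
  assumes "reduced_index p m" "reduced_index q n" "unimodular p m q n"
  shows "E_curve p m \<inter> E_curve q n = {contact_point p m q n}"
proof (intro equalityI subsetI)
  fix w assume "w \<in> {contact_point p m q n}"
  then show "w \<in> E_curve p m \<inter> E_curve q n"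
    using tangent_line_at_contact_point(1)[OF assms]
      tangent_line_at_contact_point(1)[OF assms(2,1) unimodular_sym[OF assms(3)]]
    by (simp add: contact_point_sym[of q n p m])
next
  fix w assume w: "w \<in> E_curve p m \<inter> E_curve q n"
  obtain x y where xy: "w = (x, y)" by force
  note r = reduced_indexD[OF assms(1)] reduced_indexD[OF assms(2)]
  \<comment> \<open>Taken from an index with positive numerator, since the line
    \<open>[0, 1]\<close> also contains points with negative \<open>y\<close>.\<close>
  have "0 \<le> y \<and> 0 \<le> x + y + x * y"
    using unimodular_pos[OF assms(3)] w conic_zero_imp(1,2)[of p m x y] conic_zero_imp(1,2)[of q n x y] r
    unfolding xy by (auto simp: E_curve_eq)
  then have y: "0 \<le> y" "0 \<le> x + y + x * y" by auto
  define s where "s = sqrt (1 * x + x * y + y * 1)"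
  have s: "s\<^sup>2 = 1 * x + x * y + y * 1" using y by (simp add: s_def algebra_simps)
  have "curvature p m (1, x, y) = 0" "curvature q n (1, x, y) = 0"
    using w assms(1,2) y(1) xy by (auto intro: curvature_eq_0_on_E_curve)
  then have f: "(real p)\<^sup>2 * (1 + y) - 2 * real p * real m * s + (real m)\<^sup>2 * (x + y) = y"
     "(real q)\<^sup>2 * (1 + y) - 2 * real q * real n * s + (real n)\<^sup>2 * (x + y) = y"
    by (simp_all add: curvature_def s_def)
  define B where "B = real p * real q * (1 + y) - (real p * real n + real q * real m) * s + real m * real n * (x + y)"
  have D: "(real p * real n - real q * real m)\<^sup>2 = 1" using unimodular_det[OF assms(3)] .
  have "y * y = B\<^sup>2 + 1 * y\<^sup>2" using gram_identity[OF s, of p m q n] unfolding f D B_def by simp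
  then have "B = 0" by (simp add: power2_eq_square)
  then have B: "real p * real q * (1 + y) - (real p * real n + real q * real m) * s + real m * real n * (x + y) = 0"
    by (simp add: B_def)
  \<comment> \<open>The value at \<open>[1, 0]\<close>, which times the determinant is n times
    \<open>[p, m]\<close> minus m times \<open>[q, n]\<close>.\<close>
  have "(real p * real n - real q * real m)\<^sup>2 * (1 + y)
      = (real n)\<^sup>2 * ((real p)\<^sup>2 * (1 + y) - 2 * real p * real m * s + (real m)\<^sup>2 * (x + y))
      - 2 * real m * real n * (real p * real q * (1 + y) - (real p * real n + real q * real m) * s + real m * real n * (x + y))
      + (real m)\<^sup>2 * ((real q)\<^sup>2 * (1 + y) - 2 * real q * real n * s + (real n)\<^sup>2 * (x + y))"
    by algebra
  then have y1: "1 + y = y * ((real m)\<^sup>2 + (real n)\<^sup>2)" unfolding f B D by (simp add: algebra_simps)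
  \<comment> \<open>The value at \<open>[0, 1]\<close>, which times the determinant is p times
    \<open>[q, n]\<close> minus q times \<open>[p, m]\<close>.\<close>
  have "(real p * real n - real q * real m)\<^sup>2 * (x + y)
      = (real q)\<^sup>2 * ((real p)\<^sup>2 * (1 + y) - 2 * real p * real m * s + (real m)\<^sup>2 * (x + y))
      - 2 * real p * real q * (real p * real q * (1 + y) - (real p * real n + real q * real m) * s + real m * real n * (x + y))
      + (real p)\<^sup>2 * ((real q)\<^sup>2 * (1 + y) - 2 * real q * real n * s + (real n)\<^sup>2 * (x + y))"
    by algebra
  then have xy1: "x + y = y * ((real p)\<^sup>2 + (real q)\<^sup>2)" unfolding f B D by (simp add: algebra_simps)
  from y1 xy1 have *: "y * ((real m)\<^sup>2 + (real n)\<^sup>2 - 1) = 1" "x = y * ((real p)\<^sup>2 + (real q)\<^sup>2 - 1)"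
    by (simp_all add: algebra_simps)
  then have "(real m)\<^sup>2 + (real n)\<^sup>2 - 1 \<noteq> 0" by auto
  with *(1) have "y = 1 / ((real m)\<^sup>2 + (real n)\<^sup>2 - 1)" by (simp add: field_simps)
  then show "w \<in> {contact_point p m q n}" using *(2) by (simp add: contact_point_def xy)
qed

section \<open>Disjoint interiors\<close>

lemma E_interiorD:
  assumes "(x, y) \<in> E_interior p m" "reduced_index p m" "1 \<le> p"
  shows "0 < y" "0 < x + y + x * y" "curvature p m (1, x, y) < 0" "conic p m (x, y) < 0"
proof -
  note r = reduced_indexD[OF assms(2)]
  show c: "conic p m (x, y) < 0" using assms E_interior_eq[of p m] r by auto
  show "0 < y" "0 < x + y + x * y" "curvature p m (1, x, y) < 0"
    using conic_neg_imp[OF c assms(3) r(1)] by auto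
qed

lemma E_interior_disjoint:
  assumes "reduced_index p m" "reduced_index q n" "real p / real m \<noteq> real q / real n"
  shows "E_interior p m \<inter> E_interior q n = {}"
proof -
  \<comment> \<open>The index with \<open>1 \<le> p\<close> supplies \<open>0 < y\<close> for
    \<open>det_bound\<close>. The other may be \<open>[0, 1]\<close>, whose curvature is
    \<open>x\<close>; two distinct fractions are not both 0.\<close>
  have *: "real p / real m = real q / real n"
    if "z \<in> E_interior p m" "z \<in> E_interior q n" "1 \<le> p" "reduced_index p m" "reduced_index q n"
    for p m q n z
  proof -
    obtain x y where z: "z = (x, y)" by force
    note i = E_interiorD[of x y p m, OF that(1)[unfolded z] that(4,3)]
    have "curvature q n (1, x, y) < 0"
    proof (cases "q = 0")
      case True
      then show ?thesis using that(2,5) by (auto simp: z E_interior_def curvature_def dest: reduced_indexD)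
    next
      case False
      then show ?thesis using E_interiorD(3)[of x y q n] that(2,5) z by auto
    qed
    then have "p * n = q * m" using det_bound(2)[of 1 x y p m q n] i by (simp add: algebra_simps)
    moreover have "0 < real m" "0 < real n" using that(4,5) by (auto simp: reduced_index_def)
    ultimately show ?thesis by (simp add: frac_eq_eq flip: of_nat_mult)
  qed
  have "p \<noteq> 0 \<or> q \<noteq> 0" using assms(3) by auto
  then show ?thesis using *[of _ p m q n] *[of _ q n p m] assms by fastforce
qed

section \<open>Rows of the Stern--Brocot tree\<close>

lemma insert_mediants_ends:
  "ws \<noteq> [] \<Longrightarrow> insert_mediants ws \<noteq> [] \<and> hd (insert_mediants ws) = hd ws \<and> last (insert_mediants ws) = last ws"
  by (induction ws rule: insert_mediants.induct) auto

text \<open>Insertion acts on each gap separately, so it commutes with gluing two lists at a common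
  end; \<open>tl\<close> removes the duplicate of that end.\<close>

lemma insert_mediants_join:
  "xs \<noteq> [] \<Longrightarrow> ys \<noteq> [] \<Longrightarrow> last xs = hd ys \<Longrightarrow>
     insert_mediants (xs @ tl ys) = insert_mediants xs @ tl (insert_mediants ys)"
proof (induction xs rule: insert_mediants.induct)
  case ("2_2" v)
  then show ?case by (cases ys; cases "tl ys") auto
qed auto

lemma mediants_join:
  "xs \<noteq> [] \<Longrightarrow> ys \<noteq> [] \<Longrightarrow> last xs = hd ys \<Longrightarrow>
     mediants (xs @ tl ys) = mediants xs @ mediants ys"
proof (induction xs rule: mediants.induct)
  case ("2_2" v)
  then show ?case by (cases ys; cases "tl ys") auto
qed auto

lemma mediants_map:
  assumes "\<And>u v. mediant (f u) (f v) = f (mediant u v)"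
  shows "mediants (map f ws) = map f (mediants ws)"
    and "insert_mediants (map f ws) = map f (insert_mediants ws)"
  by (induction ws rule: mediants.induct) (simp_all add: assms)

text \<open>Maps the initial pair \<open>[1, 0], [0, 1]\<close> to its left half
  \<open>[1, 0], [1, 1]\<close>; \<open>sb_right\<close> maps it to the right half
  \<open>[1, 1], [0, 1]\<close>. Both are linear and so respect mediants.\<close>

fun sb_left :: "nat \<times> nat \<Rightarrow> nat \<times> nat" where
  "sb_left (p, m) = (p + m, m)"

fun sb_right :: "nat \<times> nat \<Rightarrow> nat \<times> nat" where
  "sb_right (p, m) = (p, p + m)"

lemma mediant_sb: "mediant (sb_left u) (sb_left v) = sb_left (mediant u v)"
  "mediant (sb_right u) (sb_right v) = sb_right (mediant u v)"
  by (cases u; cases v; simp)+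

lemma sb_sequence_ends:
  "sb_sequence k \<noteq> []" "hd (sb_sequence k) = (1, 0)" "last (sb_sequence k) = (0, 1)"
  unfolding sb_sequence_def by (induction k) (use insert_mediants_ends in auto)

text \<open>The tree is two linear copies of itself, glued at \<open>[1, 1]\<close>. This recursion
  splits at the root instead of refining the leaves, and it is the one that a step of the depth
  function follows.\<close>

lemma sb_sequence_Suc:
  "sb_sequence (Suc k) = map sb_left (sb_sequence k) @ tl (map sb_right (sb_sequence k))"
proof (induction k)
  case 0
  then show ?case by (simp add: sb_sequence_def)
next
  case (Suc k)
  have "sb_sequence (Suc (Suc k)) = insert_mediants (sb_sequence (Suc k))"
    by (simp add: sb_sequence_def)
  also have "\<dots> = insert_mediants (map sb_left (sb_sequence k)) @ tl (insert_mediants (map sb_right (sb_sequence k)))"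
    unfolding Suc.IH by (rule insert_mediants_join) (simp_all add: sb_sequence_ends last_map hd_map)
  also have "\<dots> = map sb_left (sb_sequence (Suc k)) @ tl (map sb_right (sb_sequence (Suc k)))"
    by (simp add: mediants_map mediant_sb sb_sequence_def)
  finally show ?case .
qed

lemma sb_row_1: "sb_row (Suc 0) = {(1, 1)}"
  by (simp add: sb_sequence_def)

lemma sb_row_Suc_Suc: "sb_row (Suc (Suc k)) = sb_left ` sb_row (Suc k) \<union> sb_right ` sb_row (Suc k)"
proof -
  have "mediants (sb_sequence (Suc k)) = mediants (map sb_left (sb_sequence k)) @ mediants (map sb_right (sb_sequence k))"
    unfolding sb_sequence_Suc by (rule mediants_join) (simp_all add: sb_sequence_ends last_map hd_map)
  then show ?thesis by (simp add: mediants_map mediant_sb image_image)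
qed

declare sb_row.simps(2) [simp del]

lemma sb_row_cases:
  assumes "(p, m) \<in> sb_row k"
  obtains (one) "k = 1" "p = 1" "m = 1"
    | (left) j q where "k = Suc (Suc j)" "p = q + m" "(q, m) \<in> sb_row (Suc j)"
    | (right) j n where "k = Suc (Suc j)" "m = p + n" "(p, n) \<in> sb_row (Suc j)"
proof (cases k)
  case 0
  with assms show ?thesis by simp
next
  case k: (Suc i)
  show ?thesis
  proof (cases i)
    case 0
    with assms k one show ?thesis by (simp add: sb_row_1)
  next
    case (Suc j)
    then have "(p, m) \<in> sb_left ` sb_row (Suc j) \<union> sb_right ` sb_row (Suc j)"
      using assms k sb_row_Suc_Suc by simp
    then show ?thesis using left right k Suc by auto
  qed
qed

lemma sb_row_pos: "(p, m) \<in> sb_row k \<Longrightarrow> 1 \<le> p \<and> 1 \<le> m"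
proof (induction k arbitrary: p m rule: less_induct)
  case (less k)
  show ?case using less.prems
  proof (cases rule: sb_row_cases)
    case one
    then show ?thesis by simp
  next
    case (left j q)
    then show ?thesis using less.IH[of "Suc j" q m] by simp
  next
    case (right j n)
    then show ?thesis using less.IH[of "Suc j" p n] by simp
  qed
qed

text \<open>The index tells how it arose: \<open>p = m\<close> is the root, \<open>p > m\<close>
  comes from \<open>sb_left\<close> and \<open>p < m\<close> from \<open>sb_right\<close>. So both
  memberships descend to the same parent.\<close>

lemma sb_row_unique: "(p, m) \<in> sb_row k \<Longrightarrow> (p, m) \<in> sb_row l \<Longrightarrow> k = l"
proof (induction k arbitrary: p m l rule: less_induct)
  case (less k)
  show ?case using less.prems(1)
  proof (cases rule: sb_row_cases)
    case one
    with less.prems(2) show ?thesis by (cases rule: sb_row_cases) (use sb_row_pos in fastforce)+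
  next
    case 1: (left j q)
    show ?thesis using less.prems(2)
    proof (cases rule: sb_row_cases)
      case one
      then show ?thesis using 1 sb_row_pos[OF 1(3)] by simp
    next
      case (left i r)
      then show ?thesis using 1 less.IH[of "Suc j" q m "Suc i"] by simp
    next
      case (right i n)
      then show ?thesis using 1 sb_row_pos[OF 1(3)] sb_row_pos[OF right(3)] by simp
    qed
  next
    case 1: (right j n)
    show ?thesis using less.prems(2)
    proof (cases rule: sb_row_cases)
      case one
      then show ?thesis using 1 sb_row_pos[OF 1(3)] by simp
    next
      case (left i r)
      then show ?thesis using 1 sb_row_pos[OF 1(3)] sb_row_pos[OF left(3)] by simp
    next
      case (right i n)
      then show ?thesis using 1 less.IH[of "Suc j" p _ "Suc i"] by simp
    qed
  qed
qed

text \<open>The subtractive Euclidean algorithm, read backwards.\<close>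

lemma sb_row_exists: "1 \<le> p \<Longrightarrow> 1 \<le> m \<Longrightarrow> coprime p m \<Longrightarrow> \<exists>k. (p, m) \<in> sb_row (Suc k)"
proof (induction "p + m" arbitrary: p m rule: less_induct)
  case less
  consider "p = m" | "p < m" | "m < p" by linarith
  then show ?case
  proof cases
    case 1
    then have "(p, m) \<in> sb_row (Suc 0)" using less.prems by (simp add: sb_row_1)
    then show ?thesis ..
  next
    case 2
    have c: "coprime p (m - p)"
    proof (rule coprimeI)
      fix d assume d: "d dvd p" "d dvd m - p"
      have "d dvd p + (m - p)" using d by (rule dvd_add)
      then show "is_unit d" using coprime_common_divisor[OF less.prems(3) d(1)] 2 by simp
    qed
    have l: "p + (m - p) < p + m" "1 \<le> m - p" using less.prems(1) 2 by linarith+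
    obtain k where "(p, m - p) \<in> sb_row (Suc k)"
      using less.hyps[OF l(1) less.prems(1) l(2) c] ..
    then have "sb_right (p, m - p) \<in> sb_row (Suc (Suc k))"
      unfolding sb_row_Suc_Suc by (intro UnI2 imageI)
    moreover have "sb_right (p, m - p) = (p, m)" using 2 by simp
    ultimately show ?thesis by (intro exI[of _ "Suc k"]) (simp only:)
  next
    case 3
    have c: "coprime (p - m) m"
    proof (rule coprimeI)
      fix d assume d: "d dvd p - m" "d dvd m"
      have "d dvd (p - m) + m" using d by (rule dvd_add)
      then show "is_unit d" using coprime_common_divisor[OF less.prems(3) _ d(2)] 3 by simp
    qed
    have l: "p - m + m < p + m" "1 \<le> p - m" using less.prems(2) 3 by linarith+
    obtain k where "(p - m, m) \<in> sb_row (Suc k)"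
      using less.hyps[OF l(1) l(2) less.prems(2) c] ..
    then have "sb_left (p - m, m) \<in> sb_row (Suc (Suc k))"
      unfolding sb_row_Suc_Suc by (intro UnI1 imageI)
    moreover have "sb_left (p - m, m) = (p, m)" using 3 by simp
    ultimately show ?thesis by (intro exI[of _ "Suc k"]) (simp only:)
  qed
qed

lemma sb_row_number_row:
  assumes "1 \<le> p" "1 \<le> m" "coprime p m"
  shows "(p, m) \<in> sb_row (sb_row_number p m)"
proof -
  obtain k where "(p, m) \<in> sb_row k" using sb_row_exists[OF assms] by blast
  then show ?thesis unfolding sb_row_number_def by (rule theI) (use sb_row_unique \<open>(p, m) \<in> sb_row k\<close> in blast)
qed

section \<open>The depth recursion\<close>

lemma apollonian_depth_eq_0_iff: "apollonian_depth t = 0 \<longleftrightarrow> has_nonpos t"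
proof
  assume "apollonian_depth t = 0"
  then have ex: "\<exists>d. has_nonpos ((apollonian_step ^^ d) t)" and
    "(LEAST d. has_nonpos ((apollonian_step ^^ d) t)) = 0"
    by (auto simp: apollonian_depth_def zero_enat_def split: if_splits)
  then show "has_nonpos t" using LeastI_ex[OF ex] by simp
next
  assume t: "has_nonpos t"
  then have "(LEAST d. has_nonpos ((apollonian_step ^^ d) t)) = 0" by (intro Least_equality) auto
  moreover have "\<exists>d. has_nonpos ((apollonian_step ^^ d) t)" by (intro exI[of _ 0]) (simp add: t)
  ultimately show "apollonian_depth t = 0" by (simp add: apollonian_depth_def zero_enat_def)
qed

text \<open>With \<open>eSuc\<close> the recursion also covers infinite depth.\<close>

lemma apollonian_depth_step:
  assumes "\<not> has_nonpos t"
  shows "apollonian_depth t = eSuc (apollonian_depth (apollonian_step t))"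
proof -
  have shift: "(apollonian_step ^^ Suc d) t = (apollonian_step ^^ d) (apollonian_step t)" for d
    by (simp only: funpow_Suc_right comp_apply)
  show ?thesis
  proof (cases "\<exists>d. has_nonpos ((apollonian_step ^^ d) t)")
    case True
    then obtain d where d: "has_nonpos ((apollonian_step ^^ d) t)" by blast
    then have "(LEAST d. has_nonpos ((apollonian_step ^^ d) t))
        = Suc (LEAST d. has_nonpos ((apollonian_step ^^ Suc d) t))"
      by (rule Least_Suc) (use assms in simp)
    moreover have "\<exists>d. has_nonpos ((apollonian_step ^^ d) (apollonian_step t))"
      using d assms by (cases d) (auto simp: shift simp del: funpow.simps)
    ultimately show ?thesis using True by (simp add: apollonian_depth_def shift eSuc_enat del: funpow.simps)
  next
    case False
    then have "\<nexists>d. has_nonpos ((apollonian_step ^^ d) (apollonian_step t))" by (metis shift)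
    with False show ?thesis by (simp add: apollonian_depth_def)
  qed
qed

section \<open>Curvatures and the greatest entry under one step\<close>

lemma curvature_swap: "curvature p m (a, b, c) = curvature m p (b, a, c)"
  by (simp add: curvature_def algebra_simps)

text \<open>The smaller root of the Descartes circle equation; it is the curvature of the disk
  \<open>[1, 1]\<close>.\<close>

definition descartes :: "real \<times> real \<times> real \<Rightarrow> real" where
  "descartes = (\<lambda>(a, b, c). a + b + c - 2 * sqrt (a * b + b * c + c * a))"

lemma descartes_eq: "descartes (a, b, c) = a + b + c - 2 * sqrt (a * b + b * c + c * a)"
  by (simp add: descartes_def)

lemma descartes_swap: "descartes (a, b, c) = descartes (b, a, c)"
  by (simp add: descartes_eq algebra_simps)

lemma curvature_1_1 [simp]: "curvature (Suc 0) (Suc 0) = descartes"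
  by (rule ext) (auto simp: curvature_def descartes_def)

lemma apollonian_step_simps:
  "b < a \<Longrightarrow> c < a \<Longrightarrow> apollonian_step (a, b, c) = (descartes (a, b, c), b, c)"
  "a < b \<Longrightarrow> c < b \<Longrightarrow> apollonian_step (a, b, c) = (a, descartes (a, b, c), c)"
  by (auto simp: apollonian_step_def descartes_eq Let_def)

lemma apollonian_step_has_nonpos_iff:
  assumes "0 < a" "0 < b" "0 < c"
  shows "has_nonpos (apollonian_step (a, b, c)) \<longleftrightarrow> descartes (a, b, c) \<le> 0"
  using assms by (auto simp: apollonian_step_def descartes_eq Let_def has_nonpos_def)

text \<open>The absolute value is where the recursion could lose track of the index: the sign of
  \<open>s - b - c\<close> is harmless for upper bounds, and it is nonnegative if \<open>a\<close> is the greatest entry and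
  the next triple is positive (see \<open>greatest_ge_sum\<close>).\<close>

lemma sqrt_after_step:
  fixes a b c :: real
  assumes "0 \<le> a * b + b * c + c * a"
  defines "s \<equiv> sqrt (a * b + b * c + c * a)"
  defines "r \<equiv> a + b + c - 2 * s"
  shows "sqrt (r * b + b * c + c * r) = \<bar>s - b - c\<bar>"
proof -
  have "s\<^sup>2 = a * b + b * c + c * a" using assms(1) by (simp add: s_def)
  then have "r * b + b * c + c * r = (s - b - c)\<^sup>2" unfolding r_def by algebra
  then show ?thesis by simp
qed

text \<open>With \<open>s - b - c\<close> as the new square root, the step is a linear change of the
  index. The actual root is the absolute value, which can only lower the curvature, through the
  mixed term.\<close>

lemma curvature_step_le:
  assumes "0 \<le> a * b + b * c + c * a"
  shows "curvature p m (descartes (a, b, c), b, c) \<le> curvature p (p + m) (a, b, c)"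
    and "b + c \<le> sqrt (a * b + b * c + c * a) \<Longrightarrow>
      curvature p m (descartes (a, b, c), b, c) = curvature p (p + m) (a, b, c)"
proof -
  define s where "s = sqrt (a * b + b * c + c * a)"
  have "curvature p m (descartes (a, b, c), b, c)
     = (real p)\<^sup>2 * (a + b + 2 * c - 2 * s) - 2 * real p * real m * \<bar>s - b - c\<bar> + (real m)\<^sup>2 * (b + c) - c"
    using sqrt_after_step[OF assms] unfolding descartes_eq s_def by (simp add: curvature_def algebra_simps)
  moreover have "curvature p (p + m) (a, b, c)
     = (real p)\<^sup>2 * (a + b + 2 * c - 2 * s) - 2 * real p * real m * (s - b - c) + (real m)\<^sup>2 * (b + c) - c"
    by (simp add: curvature_def s_def algebra_simps power2_eq_square)
  moreover have "2 * real p * real m * (s - b - c) \<le> 2 * real p * real m * \<bar>s - b - c\<bar>"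
    by (intro mult_left_mono) auto
  ultimately show "curvature p m (descartes (a, b, c), b, c) \<le> curvature p (p + m) (a, b, c)"
    "b + c \<le> sqrt (a * b + b * c + c * a) \<Longrightarrow>
      curvature p m (descartes (a, b, c), b, c) = curvature p (p + m) (a, b, c)"
    by (simp_all flip: s_def)
qed

text \<open>For \<open>p \<le> m\<close> the curvature is \<open>p * m\<close> times that of
  \<open>[1, 1]\<close> plus nonnegative terms; the other case is the mirror image.
  Contrapositively, \<open>c\<close> is not greatest while \<open>[1, 1]\<close> is positive and
  \<open>[p, m]\<close> is not.\<close>

lemma curvature_third_greatest:
  assumes "0 < a" "0 < b" "a \<le> c" "b \<le> c" "1 \<le> p" "1 \<le> m" "0 < descartes (a, b, c)"
  shows "0 < curvature p m (a, b, c)"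
proof -
  have *: "0 < curvature p m (a, b, c)"
    if h: "0 < a" "0 < b" "a \<le> c" "b \<le> c" "1 \<le> p" "p \<le> m" "0 < descartes (a, b, c)" for p m a b
  proof -
    have "curvature p m (a, b, c) = real p * real m * descartes (a, b, c)
       + c * ((real m - real p)\<^sup>2 + ((real p)\<^sup>2 - 1)) + (c - a) * (real p * (real m - real p))
       + b * (real m * (real m - real p))"
      unfolding descartes_eq by (simp add: curvature_def algebra_simps power2_eq_square)
    moreover have "0 < real p * real m * descartes (a, b, c)" using h by simp
    moreover have "0 \<le> c * ((real m - real p)\<^sup>2 + ((real p)\<^sup>2 - 1))" using h by simp
    moreover have "0 \<le> (c - a) * (real p * (real m - real p))" using h by simp
    moreover have "0 \<le> b * (real m * (real m - real p))" using h by simp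
    ultimately show ?thesis by linarith
  qed
  show ?thesis
  proof (cases "p \<le> m")
    case True
    then show ?thesis using * assms by blast
  next
    case False
    then show ?thesis using *[of b a m p] assms curvature_swap[of p m a b c] descartes_swap[of a b c] by simp
  qed
qed

lemma second_less_first:
  assumes "0 \<le> a * b + b * c + c * a" "0 < a" "0 < c" "1 \<le> p" "p < m" "curvature p m (a, b, c) \<le> 0"
  shows "b < a"
proof (rule ccontr)
  assume "\<not> b < a"
  have m: "(real p)\<^sup>2 \<le> (real m)\<^sup>2" using assms by (intro power_mono) auto
  \<comment> \<open>otherwise the distinct disks \<open>[p, m]\<close> and \<open>[m, p]\<close> would both have nonpositive curvature\<close>
  have "curvature m p (a, b, c) = curvature p m (a, b, c) - ((real m)\<^sup>2 - (real p)\<^sup>2) * (b - a)"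
    by (simp add: curvature_def algebra_simps)
  also have "\<dots> \<le> 0" using assms(6) \<open>\<not> b < a\<close> mult_nonneg_nonneg[of "(real m)\<^sup>2 - (real p)\<^sup>2" "b - a"] m
    by linarith
  finally have "(real m * real m - real p * real p)\<^sup>2 \<le> 1"
    using det_bound(1)[OF assms(1), of m p p m] assms by simp
  moreover have "2 \<le> real m * real m - real p * real p"
  proof -
    have "real p + 1 \<le> real m" "1 \<le> real p" using assms by auto
    then have "(real p + 1) * (real p + 1) \<le> real m * real m" by (intro mult_mono) auto
    then show ?thesis using \<open>1 \<le> real p\<close> by (simp add: algebra_simps)
  qed
  then have "2\<^sup>2 \<le> (real m * real m - real p * real p)\<^sup>2" by (intro power_mono) auto
  ultimately show False by simp
qed

text \<open>Decides which entry the step replaces. Strictness excludes ties and makes the choice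
  stable under small perturbations.\<close>

lemma greatest_if_curvature_le:
  assumes "0 < a" "0 < b" "0 < c" "1 \<le> p" "p < m" "curvature p m (a, b, c) \<le> 0"
    and "0 < descartes (a, b, c)"
  shows "b < a" "c < a"
proof -
  have "0 \<le> a * b + b * c + c * a" using assms by simp
  then show "b < a" using second_less_first[of a b c p m] assms by simp
  then show "c < a" using curvature_third_greatest[of a b c p m] assms by force
qed

lemma has_nonpos_triple: "has_nonpos (a, b, c) \<longleftrightarrow> a \<le> 0 \<or> b \<le> 0 \<or> c \<le> 0"
  by (simp add: has_nonpos_def)

text \<open>Induction up the tree: each step moves the index to its parent. Negativity survives
  because \<open>curvature_step_le\<close> bounds the new curvature from above, and at the root
  \<open>[1, 1]\<close> the step produces a negative entry.\<close>

lemma apollonian_depth_if_curvature_neg: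
  assumes "(p, m) \<in> sb_row k" "0 < a" "0 < b" "0 < c" "curvature p m (a, b, c) < 0"
  shows "apollonian_depth (a, b, c) = enat k"
  using assms
proof (induction k arbitrary: p m a b rule: less_induct)
  case (less k)
  have pos: "0 \<le> a * b + b * c + c * a" "0 \<le> b * a + a * c + c * b" using less.prems by simp_all
  have step: "apollonian_depth (a, b, c) = eSuc (apollonian_depth (apollonian_step (a, b, c)))"
    using less.prems by (intro apollonian_depth_step) (simp add: has_nonpos_triple)
  \<comment> \<open>Beside a disk of negative curvature no disk with a different index is
    nonpositive.\<close>
  have curv_pos: "0 < descartes (a, b, c)" if "p \<noteq> m"
    using det_bound(2)[OF pos(1), of p m 1 1] less.prems that by force
  show ?case using less.prems(1)
  proof (cases rule: sb_row_cases)
    case one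
    then have "has_nonpos (apollonian_step (a, b, c))"
      using apollonian_step_has_nonpos_iff[of a b c] less.prems by simp
    then have "apollonian_depth (apollonian_step (a, b, c)) = 0" by (simp add: apollonian_depth_eq_0_iff)
    then show ?thesis using step one by (simp add: one_eSuc[symmetric] one_enat_def)
  next
    case (left j q)
    note q = sb_row_pos[OF left(3)]
    have cp: "0 < descartes (a, b, c)" using curv_pos left q by simp
    then have "a < b" "c < b"
      using greatest_if_curvature_le[of b a c m p] left q less.prems
      unfolding curvature_swap[of m p b] descartes_swap[of b] by simp_all
    then have "apollonian_step (a, b, c) = (a, descartes (a, b, c), c)" by (rule apollonian_step_simps)
    moreover have "apollonian_depth (a, descartes (a, b, c), c) = enat (Suc j)"
    proof (rule less.IH)
      show "curvature q m (a, descartes (a, b, c), c) < 0"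
        using curvature_step_le(1)[OF pos(2), of m q] less.prems(5) left(2)
        unfolding curvature_swap[of q m a] curvature_swap[of p m a] descartes_swap[of a b]
        by (simp add: add.commute)
    qed (use less.prems left cp in auto)
    ultimately show ?thesis using step left by (simp add: eSuc_enat)
  next
    case (right j n)
    note q = sb_row_pos[OF right(3)]
    have cp: "0 < descartes (a, b, c)" using curv_pos right q by simp
    then have "b < a" "c < a"
      using greatest_if_curvature_le[of a b c p m] right q less.prems by simp_all
    then have "apollonian_step (a, b, c) = (descartes (a, b, c), b, c)" by (rule apollonian_step_simps)
    moreover have "apollonian_depth (descartes (a, b, c), b, c) = enat (Suc j)"
    proof (rule less.IH)
      show "curvature p n (descartes (a, b, c), b, c) < 0"
        using curvature_step_le(1)[OF pos(1), of p n] less.prems(5) right(2) by simp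
    qed (use less.prems right cp in auto)
    ultimately show ?thesis using step right by (simp add: eSuc_enat)
  qed
qed

section \<open>The depth just outside a curve\<close>

text \<open>Removes the absolute value of \<open>sqrt_after_step\<close>, so that the index change
  is exact. Positivity of \<open>descartes\<close> with \<open>a\<close> greatest forces
  \<open>b + c \<le> a\<close>, and then the radicand is at least
  \<open>(b + c)\<^sup>2\<close>.\<close>

lemma greatest_ge_sum:
  fixes a b c :: real
  assumes "0 < b" "0 < c" "b < a" "c < a" "0 < descartes (a, b, c)"
  shows "b + c \<le> sqrt (a * b + b * c + c * a)"
proof -
  have *: "b + c \<le> a" if "0 < b" "0 < c" "b < a" "c \<le> b" "2 * sqrt (a * b + b * c + c * a) < a + b + c" for b c
  proof (rule ccontr)
    assume "\<not> b + c \<le> a"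
    have "(2 * sqrt (a * b + b * c + c * a))\<^sup>2 < (a + b + c)\<^sup>2" using that by (intro power_strict_mono) auto
    then have "4 * (a * b + b * c + c * a) < (a + b + c)\<^sup>2" using that by (simp add: power_mult_distrib)
    moreover have "(a + b + c)\<^sup>2 - 4 * (a * b + b * c + c * a) = (a - b) * (a - (b + c)) - c * (a - c) - 3 * b * c"
      by (simp add: power2_eq_square algebra_simps)
    moreover have "(a - b) * (a - (b + c)) \<le> 0" using that \<open>\<not> b + c \<le> a\<close> by (intro mult_nonneg_nonpos) auto
    moreover have "0 \<le> c * (a - c)" "0 < 3 * b * c" using that by auto
    ultimately show False by linarith
  qed
  have "b + c \<le> a"
    using *[of b c] *[of c b] assms by (cases "c \<le> b") (simp_all add: descartes_eq algebra_simps)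
  then have "(b + c) * (b + c) \<le> a * (b + c)" using assms by (intro mult_right_mono) auto
  moreover have "0 < b * c" using assms by simp
  ultimately have "(b + c)\<^sup>2 \<le> a * b + b * c + c * a" by (simp add: power2_eq_square algebra_simps)
  then show ?thesis by (rule real_le_rsqrt)
qed

lemma tendsto_curvature: "(curvature p m \<longlongrightarrow> curvature p m t) (nhds t)"
proof -
  have "curvature p m = (\<lambda>w. (real p)\<^sup>2 * (fst w + snd (snd w))
     - 2 * real p * real m * sqrt (fst w * fst (snd w) + fst (snd w) * snd (snd w) + snd (snd w) * fst w)
     + (real m)\<^sup>2 * (fst (snd w) + snd (snd w)) - snd (snd w))"
    by (simp add: curvature_def case_prod_unfold)
  then have "isCont (curvature p m) t" by (simp only:) (intro continuous_intros)
  then show ?thesis unfolding isCont_def tendsto_at_iff_tendsto_nhds .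
qed

lemma tendsto_descartes: "(descartes \<longlongrightarrow> descartes t) (nhds t)"
  using tendsto_curvature[of 1 1 t] by simp

lemma eventually_less_nhds:
  fixes f g :: "'a :: topological_space \<Rightarrow> real"
  assumes "(f \<longlongrightarrow> f t) (nhds t)" "(g \<longlongrightarrow> g t) (nhds t)" "f t < g t"
  shows "\<forall>\<^sub>F w in nhds t. f w < g w"
  using order_tendstoD(1)[OF tendsto_diff[OF assms(2,1)], of 0] assms(3) by simp

lemma tendsto_components:
  "((\<lambda>w. fst w) \<longlongrightarrow> fst t) (nhds t)" "((\<lambda>w. fst (snd w)) \<longlongrightarrow> fst (snd t)) (nhds t)"
  "((\<lambda>w. snd (snd w)) \<longlongrightarrow> snd (snd t)) (nhds t)" for t :: "real \<times> real \<times> real"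
  by (intro tendsto_intros filterlim_ident)+

text \<open>Near the boundary point the step replaces the same entry, is continuous, and changes the
  index exactly, so the claim for the parent index is pulled back along it. At the root, positive
  curvature of \<open>[1, 1]\<close> means that the depth is not 1.\<close>

lemma apollonian_depth_outside:
  assumes "(p, m) \<in> sb_row k" "0 < a" "0 < b" "0 < c" "curvature p m (a, b, c) = 0"
    and "apollonian_depth (a, b, c) = enat k"
  shows "\<forall>\<^sub>F w in nhds (a, b, c). 0 < curvature p m w \<longrightarrow> apollonian_depth w \<noteq> enat k"
  using assms
proof (induction k arbitrary: p m a b rule: less_induct)
  case (less k)
  define t where "t = (a, b, c)"
  have pos: "0 \<le> a * b + b * c + c * a" "0 \<le> b * a + a * c + c * b" using less.prems by simp_all
  have step: "apollonian_depth w = eSuc (apollonian_depth (apollonian_step w))"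
    if "0 < fst w" "0 < fst (snd w)" "0 < snd (snd w)" for w
    using that by (intro apollonian_depth_step) (simp add: has_nonpos_def case_prod_unfold)
  have ev: "\<forall>\<^sub>F w in nhds t. 0 < fst w" "\<forall>\<^sub>F w in nhds t. 0 < fst (snd w)" "\<forall>\<^sub>F w in nhds t. 0 < snd (snd w)"
    using less.prems by (intro eventually_less_nhds tendsto_components tendsto_const; simp add: t_def)+
  \<comment> \<open>Where \<open>[p, m]\<close> and \<open>[1, 1]\<close> touch, both curvatures
    vanish, so \<open>det_bound\<close> does not suffice; instead, a nonpositive value would make
    the depth 1.\<close>
  have curv_pos: "0 < descartes t" if "k \<noteq> 1"
  proof (rule ccontr)
    assume "\<not> 0 < descartes t"
    then have "has_nonpos (apollonian_step t)"
      using apollonian_step_has_nonpos_iff[of a b c] less.prems by (simp add: t_def)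
    then have "apollonian_depth t = eSuc 0"
      using step[of t] less.prems by (simp add: t_def apollonian_depth_eq_0_iff[symmetric])
    then show False using less.prems that by (simp add: t_def one_eSuc[symmetric] one_enat_def)
  qed
  show ?case using less.prems(1) unfolding t_def[symmetric]
  proof (cases rule: sb_row_cases)
    case one
    have *: "0 < descartes w \<longrightarrow> apollonian_depth w \<noteq> enat 1"
      if "0 < fst w" "0 < fst (snd w)" "0 < snd (snd w)" for w
    proof
      assume "0 < descartes w"
      then have "\<not> has_nonpos (apollonian_step w)"
        using that apollonian_step_has_nonpos_iff[of "fst w" "fst (snd w)" "snd (snd w)"] by simp
      then have "apollonian_depth (apollonian_step w) \<noteq> 0" by (simp add: apollonian_depth_eq_0_iff)
      then show "apollonian_depth w \<noteq> enat 1"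
        unfolding step[OF that] by (metis one_eSuc eSuc_inject one_enat_def)
    qed
    show "\<forall>\<^sub>F w in nhds t. 0 < curvature p m w \<longrightarrow> apollonian_depth w \<noteq> enat k"
      using ev
    proof eventually_elim
      case (elim w)
      then show ?case using *[of w] one by simp
    qed
  next
    case (left j q)
    note q = sb_row_pos[OF left(3)]
    define S where "S w = (fst w, descartes w, snd (snd w))" for w
    have cp: "0 < descartes t" using curv_pos left q by simp
    have g: "a < b" "c < b"
      using greatest_if_curvature_le[of b a c m p] left q less.prems cp
      unfolding curvature_swap[of m p b] descartes_swap[of b] t_def by simp_all
    have S: "(S \<longlongrightarrow> S t) (nhds t)" unfolding S_def
      by (intro tendsto_Pair tendsto_descartes tendsto_components)
    have gev: "\<forall>\<^sub>F w in nhds t. fst w < fst (snd w)" "\<forall>\<^sub>F w in nhds t. snd (snd w) < fst (snd w)"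
      "\<forall>\<^sub>F w in nhds t. 0 < descartes w"
      using g cp by (intro eventually_less_nhds tendsto_components tendsto_const tendsto_descartes; simp add: t_def)+
    have St: "apollonian_step w = S w" "curvature q m (S w) = curvature p m w"
      if "0 < fst w" "0 < fst (snd w)" "0 < snd (snd w)" "fst w < fst (snd w)" "snd (snd w) < fst (snd w)"
        "0 < descartes w" for w
    proof -
      obtain x y z where w: "w = (x, y, z)" by (cases w)
      show "apollonian_step w = S w" using that by (simp add: w S_def apollonian_step_simps(2))
      have "x + z \<le> sqrt (y * x + x * z + z * y)"
        using that by (intro greatest_ge_sum) (auto simp: w descartes_swap[of y])
      then show "curvature q m (S w) = curvature p m w"
        using curvature_step_le(2)[of y x z m q] that left(2)
        unfolding w S_def fst_conv snd_conv curvature_swap[of q m x] curvature_swap[of p m x] descartes_swap[of x y]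
        by (simp add: add.commute)
    qed
    have "\<forall>\<^sub>F u in nhds (S t). 0 < curvature q m u \<longrightarrow> apollonian_depth u \<noteq> enat (Suc j)"
      unfolding S_def t_def fst_conv snd_conv
    proof (rule less.IH)
      show "curvature q m (a, descartes (a, b, c), c) = 0"
        using St(2)[of t] less.prems g cp by (simp add: t_def S_def)
      have "eSuc (apollonian_depth (S t)) = eSuc (enat (Suc j))"
        using step[of t] St(1)[of t] less.prems g cp left(1) by (simp add: t_def eSuc_enat)
      then show "apollonian_depth (a, descartes (a, b, c), c) = enat (Suc j)"
        unfolding eSuc_inject by (simp add: S_def t_def)
    qed (use less.prems left cp in \<open>auto simp: t_def\<close>)
    then have "\<forall>\<^sub>F w in nhds t. 0 < curvature q m (S w) \<longrightarrow> apollonian_depth (S w) \<noteq> enat (Suc j)"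
      by (rule eventually_compose_filterlim[OF _ S])
    then show "\<forall>\<^sub>F w in nhds t. 0 < curvature p m w \<longrightarrow> apollonian_depth w \<noteq> enat k"
      using ev gev
    proof eventually_elim
      case (elim w)
      have "apollonian_depth w = eSuc (apollonian_depth (S w))" using step[of w] St(1)[of w] elim by simp
      moreover have "enat k = eSuc (enat (Suc j))" using left(1) by (simp add: eSuc_enat)
      ultimately show ?case using St(2)[of w] elim by simp
    qed
  next
    case (right j n)
    note q = sb_row_pos[OF right(3)]
    define S where "S w = (descartes w, snd w)" for w
    have cp: "0 < descartes t" using curv_pos right q by simp
    have g: "b < a" "c < a"
      using greatest_if_curvature_le[of a b c p m] right q less.prems cp by (simp_all add: t_def)
    have S: "(S \<longlongrightarrow> S t) (nhds t)" unfolding S_def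
      by (intro tendsto_Pair tendsto_descartes tendsto_snd filterlim_ident)
    have gev: "\<forall>\<^sub>F w in nhds t. fst (snd w) < fst w" "\<forall>\<^sub>F w in nhds t. snd (snd w) < fst w"
      "\<forall>\<^sub>F w in nhds t. 0 < descartes w"
      using g cp by (intro eventually_less_nhds tendsto_components tendsto_const tendsto_descartes; simp add: t_def)+
    have St: "apollonian_step w = S w" "curvature p n (S w) = curvature p m w"
      if "0 < fst w" "0 < fst (snd w)" "0 < snd (snd w)" "fst (snd w) < fst w" "snd (snd w) < fst w"
        "0 < descartes w" for w
    proof -
      obtain x y z where w: "w = (x, y, z)" by (cases w)
      show "apollonian_step w = S w" using that by (simp add: w S_def apollonian_step_simps(1))
      have "y + z \<le> sqrt (x * y + y * z + z * x)"
        using that by (intro greatest_ge_sum) (auto simp: w)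
      then show "curvature p n (S w) = curvature p m w"
        using curvature_step_le(2)[of x y z p n] that right(2) by (simp add: w S_def)
    qed
    have "\<forall>\<^sub>F u in nhds (S t). 0 < curvature p n u \<longrightarrow> apollonian_depth u \<noteq> enat (Suc j)"
      unfolding S_def t_def fst_conv snd_conv
    proof (rule less.IH)
      show "curvature p n (descartes (a, b, c), b, c) = 0"
        using St(2)[of t] less.prems g cp by (simp add: t_def S_def)
      have "eSuc (apollonian_depth (S t)) = eSuc (enat (Suc j))"
        using step[of t] St(1)[of t] less.prems g cp right(1) by (simp add: t_def eSuc_enat)
      then show "apollonian_depth (descartes (a, b, c), b, c) = enat (Suc j)"
        unfolding eSuc_inject by (simp add: S_def t_def)
    qed (use less.prems right cp in \<open>auto simp: t_def\<close>)
    then have "\<forall>\<^sub>F w in nhds t. 0 < curvature p n (S w) \<longrightarrow> apollonian_depth (S w) \<noteq> enat (Suc j)"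
      by (rule eventually_compose_filterlim[OF _ S])
    then show "\<forall>\<^sub>F w in nhds t. 0 < curvature p m w \<longrightarrow> apollonian_depth w \<noteq> enat k"
      using ev gev
    proof eventually_elim
      case (elim w)
      have "apollonian_depth w = eSuc (apollonian_depth (S w))" using step[of w] St(1)[of w] elim by simp
      moreover have "enat k = eSuc (enat (Suc j))" using right(1) by (simp add: eSuc_enat)
      ultimately show ?case using St(2)[of w] elim by simp
    qed
  qed
qed

section \<open>Plateaus\<close>

text \<open>By the boundary condition \<open>X\<close> is relatively closed, and by assumption
  relatively open, in every connected subset \<open>d\<close> of the level interior that contains
  it. So \<open>d\<close> is \<open>X\<close>, and \<open>X\<close> is a component.\<close>

lemma is_plateauI:
  assumes X: "X \<noteq> {}" "connected X" "X \<subseteq> unit_square" "openin (top_of_set unit_square) X"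
    and depth: "\<And>z. z \<in> X \<Longrightarrow> reduced_depth z = k"
    and boundary: "\<And>z. z \<in> closure X \<Longrightarrow> z \<notin> X \<Longrightarrow>
      z \<notin> (top_of_set unit_square) interior_of {z \<in> unit_square. reduced_depth z = k}"
  shows "is_plateau X"
proof -
  define I where "I = (top_of_set unit_square) interior_of {z \<in> unit_square. reduced_depth z = k}"
  have "X \<subseteq> I" unfolding I_def using X depth by (intro interior_of_maximal) auto
  have "I \<subseteq> {z \<in> unit_square. reduced_depth z = k}" unfolding I_def by (rule interior_of_subset)
  then have I: "I \<subseteq> unit_square" by auto
  have "d = X" if d: "X \<subseteq> d" "d \<subseteq> I" "connected d" for d
  proof -
    have "openin (top_of_set d) X"
      using X(4) d(1,2) I by (meson openin_subset_trans subset_trans)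
    moreover have "d \<inter> closure X = X" using d(1,2) boundary closure_subset unfolding I_def by blast
    then have "closedin (top_of_set d) X" by (metis closed_closure closedin_closed)
    ultimately show ?thesis using d(3) X(1) unfolding connected_clopen by blast
  qed
  then have "X \<in> components I"
    using X \<open>X \<subseteq> I\<close> by (auto simp: in_components_maximal)
  then show ?thesis unfolding is_plateau_def I_def by blast
qed

section \<open>Geometry of the conic regions\<close>

lemma continuous_on_conic [continuous_intros]:
  "continuous_on S f \<Longrightarrow> continuous_on S (\<lambda>w. conic p m (f w))"
  unfolding conic_def case_prod_unfold by (intro continuous_intros)

lemma open_conic_neg: "open {z. conic p m z < 0}"
  by (intro open_Collect_less continuous_intros)

lemma closed_conic_nonpos: "closed {z. conic p m z \<le> 0}"
  by (intro closed_Collect_le continuous_intros)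

text \<open>Interpolation of a quadratic polynomial on a line from its values at
  \<open>t = 0\<close> and \<open>t = -1\<close>, with leading coefficient \<open>Q\<close>.
  Negative \<open>t\<close> gives convexity; positive \<open>t\<close> leaves the region through the
  boundary point \<open>z\<close>.\<close>

lemma conic_affine_combination:
  assumes "1 \<le> m"
  obtains Q :: real where "0 \<le> Q"
    "\<And>t. conic p m (z + t *\<^sub>R (z - c)) = (1 + t) * conic p m z - t * conic p m c + t * (1 + t) * Q"
proof -
  obtain x y where z: "z = (x, y)" by force
  obtain u v where c: "c = (u, v)" by force
  define l where "l = (real m)\<^sup>2 - (real p)\<^sup>2 - 1"
  define Q where "Q = ((real m)\<^sup>2 * (x - u) + l * (y - v))\<^sup>2 + 4 * (real p)\<^sup>2 * (((real m)\<^sup>2 - 1) * (y - v)\<^sup>2)"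
  show ?thesis
  proof
    show "0 \<le> Q" unfolding Q_def using assms by simp
    show "conic p m (z + t *\<^sub>R (z - c)) = (1 + t) * conic p m z - t * conic p m c + t * (1 + t) * Q" for t
      unfolding z c Q_def conic_def l_def by (simp add: algebra_simps power2_eq_square)
  qed
qed

lemma convex_conic_neg:
  assumes "1 \<le> m"
  shows "convex {z. conic p m z < 0}"
  unfolding convex_alt
proof (intro ballI allI impI)
  fix z c and u :: real
  assume zc: "z \<in> {z. conic p m z < 0}" "c \<in> {z. conic p m z < 0}" and u: "0 \<le> u \<and> u \<le> 1"
  obtain Q where Q: "0 \<le> Q"
    "\<And>t. conic p m (z + t *\<^sub>R (z - c)) = (1 + t) * conic p m z - t * conic p m c + t * (1 + t) * Q"
    using conic_affine_combination assms by metis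
  have "(1 - u) *\<^sub>R z + u *\<^sub>R c = z + (- u) *\<^sub>R (z - c)" by (simp add: algebra_simps)
  then have "conic p m ((1 - u) *\<^sub>R z + u *\<^sub>R c) = (1 - u) * conic p m z + u * conic p m c - u * (1 - u) * Q"
    using Q(2)[of "- u"] by simp
  moreover have "0 \<le> u * (1 - u) * Q" using u Q(1) by simp
  moreover have "(1 - u) * conic p m z + u * conic p m c < 0"
  proof (cases "u = 0")
    case False
    then have "u * conic p m c < 0" using u zc(2) by (intro mult_pos_neg) auto
    moreover have "(1 - u) * conic p m z \<le> 0" using u zc(1) by (intro mult_nonneg_nonpos) auto
    ultimately show ?thesis by linarith
  qed (use zc in simp)
  ultimately show "(1 - u) *\<^sub>R z + u *\<^sub>R c \<in> {z. conic p m z < 0}" by simp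
qed

text \<open>The disk \<open>[0, 1]\<close> has curvature \<open>x\<close>, which cannot be
  nonpositive while that of \<open>[p, m]\<close> is negative.\<close>

lemma E_interior_fst_pos:
  assumes "(x, y) \<in> E_interior p m" "reduced_index p m" "1 \<le> p"
  shows "0 < x"
proof (rule ccontr)
  assume "\<not> 0 < x"
  note i = E_interiorD[OF assms]
  have "curvature 0 1 (1, x, y) \<le> 0" using \<open>\<not> 0 < x\<close> by (simp add: curvature_def)
  then have "p * 1 = 0 * m" using det_bound(2)[of 1 x y p m 0 1] i by (simp add: algebra_simps)
  then show False using assms(3) by simp
qed

lemma conic_nonpos_imp:
  assumes "conic p m (x, y) \<le> 0" "1 \<le> p" "2 \<le> m"
  shows "y < 1"
proof (rule ccontr)
  assume "\<not> y < 1"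
  have "0 \<le> ((real m)\<^sup>2 * x + ((real m)\<^sup>2 - (real p)\<^sup>2 - 1) * y - (real p)\<^sup>2)\<^sup>2" by simp
  then have "4 * (real p)\<^sup>2 * (((real m)\<^sup>2 - 1) * y\<^sup>2 - y) \<le> 0"
    using assms(1) unfolding conic_def case_prod_conv by linarith
  then have "((real m)\<^sup>2 - 1) * y\<^sup>2 \<le> y" using assms(2) by (simp add: mult_le_0_iff)
  moreover have "2\<^sup>2 \<le> (real m)\<^sup>2" using assms(3) by (intro power_mono) auto
  then have "3 * y\<^sup>2 \<le> ((real m)\<^sup>2 - 1) * y\<^sup>2" by (intro mult_right_mono) auto
  moreover have "y \<le> y\<^sup>2" using \<open>\<not> y < 1\<close> by (simp add: power2_eq_square)
  ultimately show False using \<open>\<not> y < 1\<close> by linarith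
qed

lemma E_interior_subset_unit_square:
  assumes "reduced_index p m" "1 \<le> p" "2 \<le> m"
  shows "E_interior p m \<subseteq> unit_square"
proof
  fix z assume "z \<in> E_interior p m"
  then obtain x y where z: "z = (x, y)" and i: "(x, y) \<in> E_interior p m" by (cases z) auto
  note c = E_interiorD[OF i assms(1,2)]
  have "p \<noteq> m" using reduced_indexD(5)[OF assms(1)] assms(3) by auto
  then have "p < m" using reduced_indexD(2)[OF assms(1)] by simp
  then have "x < 1" using second_less_first[of 1 x y p m] c assms by (simp add: algebra_simps)
  moreover have "y < 1" using conic_nonpos_imp[of p m x y] c assms by simp
  moreover have "0 < x" using E_interior_fst_pos[OF i assms(1,2)] .
  ultimately show "z \<in> unit_square" using c(1) by (simp add: z unit_square_def)
qed

lemma reduced_depth_E_interior: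
  assumes "z \<in> E_interior p m" "reduced_index p m" "1 \<le> p"
  shows "reduced_depth z = enat (sb_row_number p m)"
proof -
  obtain x y where z: "z = (x, y)" by force
  note i = E_interiorD[OF assms(1)[unfolded z] assms(2,3)]
  have "0 < x" using E_interior_fst_pos[OF assms(1)[unfolded z] assms(2,3)] .
  moreover have "(p, m) \<in> sb_row (sb_row_number p m)"
    using assms by (intro sb_row_number_row) (auto simp: reduced_index_def)
  ultimately have "apollonian_depth (1, x, y) = enat (sb_row_number p m)"
    using i by (intro apollonian_depth_if_curvature_neg) auto
  then show ?thesis by (simp add: reduced_depth_def z)
qed

text \<open>The ray from the inner point \<open>c\<close> through \<open>z\<close> has positive
  \<open>conic\<close> beyond \<open>z\<close>. Its points close to \<open>z\<close> lie in the
  square and, by \<open>apollonian_depth_outside\<close>, do not have depth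
  \<open>k\<close>.\<close>

lemma not_interior_of_level:
  assumes "reduced_index p m" "1 \<le> p" "conic p m z = 0" "conic p m c < 0"
    and pos: "0 < fst z" "0 < snd z"
    and k: "(p, m) \<in> sb_row k"
    and sq: "\<forall>\<^sub>F t in at_right 0. z + t *\<^sub>R (z - c) \<in> unit_square"
  shows "z \<notin> (top_of_set unit_square) interior_of {z \<in> unit_square. reduced_depth z = enat k}"
proof
  assume "z \<in> (top_of_set unit_square) interior_of {z \<in> unit_square. reduced_depth z = enat k}"
  then obtain T where T: "open T" "z \<in> T" "z \<in> unit_square"
    and level: "unit_square \<inter> T \<subseteq> {z \<in> unit_square. reduced_depth z = enat k}"
    unfolding interior_of_def openin_open by blast
  note m = reduced_indexD(1)[OF assms(1)]
  define w where "w t = z + t *\<^sub>R (z - c)" for t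
  have red: "reduced_depth v = apollonian_depth (1, v)" for v
    by (cases v) (simp add: reduced_depth_def)
  have zero: "curvature p m (1, z) = 0"
    using curvature_pos_iff(2)[of "fst z" "snd z" m p] pos m assms(3) by simp
  have "apollonian_depth (1, z) = enat k" using level T by (auto simp: red)
  then have out: "\<forall>\<^sub>F v in nhds (1, z). 0 < curvature p m v \<longrightarrow> apollonian_depth v \<noteq> enat k"
    using apollonian_depth_outside[OF k, of 1 "fst z" "snd z"] pos zero by simp
  have "(w \<longlongrightarrow> z + 0 *\<^sub>R (z - c)) (at_right 0)" unfolding w_def by (intro tendsto_intros)
  then have w: "(w \<longlongrightarrow> z) (at_right 0)" by simp
  have "((\<lambda>t. (1, w t)) \<longlongrightarrow> (1, z)) (at_right 0)" by (intro tendsto_intros w)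
  note 1 = eventually_compose_filterlim[OF out this]
  note 2 = topological_tendstoD[OF w T(1,2)]
  note 3 = order_tendstoD(1)[OF tendsto_fst[OF w] pos(1)]
  note 4 = order_tendstoD(1)[OF tendsto_snd[OF w] pos(2)]
  have 5: "\<forall>\<^sub>F t in at_right 0. (0 :: real) < t" by (simp add: eventually_at_right_less)
  have "\<forall>\<^sub>F t in at_right (0 :: real). False"
    using 1 2 3 4 5 sq
  proof eventually_elim
    case (elim t)
    obtain Q where Q: "0 \<le> Q"
      "\<And>t. conic p m (z + t *\<^sub>R (z - c)) = (1 + t) * conic p m z - t * conic p m c + t * (1 + t) * Q"
      using conic_affine_combination m by metis
    have "0 < - t * conic p m c" using elim(5) assms(4) by (simp add: mult_pos_neg)
    moreover have "0 \<le> t * (1 + t) * Q" using elim(5) Q(1) by simp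
    ultimately have "0 < conic p m (w t)" unfolding w_def Q(2) assms(3) by simp
    then have "0 < curvature p m (1, w t)"
      using curvature_pos_iff(1)[of "fst (w t)" "snd (w t)" m p] elim(3,4) m by simp
    then have "apollonian_depth (1, w t) \<noteq> enat k" using elim(1) by blast
    moreover have "w t \<in> unit_square \<inter> T" using elim(2,6) by (simp add: w_def)
    ultimately show False using level red by auto
  qed
  then show False by (simp add: eventually_False trivial_limit_at_right_real)
qed

lemma is_plateau_E_interior:
  assumes "reduced_index p m" "1 \<le> p"
  shows "is_plateau (E_interior p m \<inter> unit_square)"
proof -
  note r = reduced_indexD[OF assms(1)]
  have int: "E_interior p m = {z. conic p m z < 0}" using assms r by (intro E_interior_eq) auto
  define k where "k = sb_row_number p m"
  have k: "(p, m) \<in> sb_row k" unfolding k_def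
    using assms by (intro sb_row_number_row) (auto simp: reduced_index_def)
  \<comment> \<open>The source of the rays. For the parabola it must be the corner
    \<open>(1, 1)\<close>, so that going away from it stays in the square; for an ellipse the centre
    serves.\<close>
  have "\<exists>c. c \<in> E_interior p m \<and> c \<in> unit_square \<and> (m = 1 \<longrightarrow> c = (1, 1))"
  proof (cases "m = 1")
    case True
    then have "p = 1" using r assms(2) by simp
    then have "(1, 1) \<in> E_interior p m \<inter> unit_square" by (simp add: True E_interior_def unit_square_def)
    then show ?thesis by blast
  next
    case False
    then have m: "2 \<le> m" using r(1) by simp
    obtain f :: "real \<times> real \<Rightarrow> real \<times> real" and c k
      where f: "linear f" "bij f" "0 < k" "\<And>z. conic p m (c + f z) = k * ((norm z)\<^sup>2 - 1)"
      using conic_parametrization[OF assms(2) m] by metis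
    have "c + f 0 \<in> E_interior p m" using f(3) f(4)[of 0] by (simp add: int)
    then show ?thesis using E_interior_subset_unit_square[OF assms m] False by blast
  qed
  then obtain c where c: "c \<in> E_interior p m" "c \<in> unit_square" "m = 1 \<Longrightarrow> c = (1, 1)" by blast
  have sq: "unit_square = cbox (0, 0) (1, 1)" by (simp add: unit_square_def cbox_Pair_eq)
  show ?thesis
  proof (rule is_plateauI[where k = "enat k"])
    show "E_interior p m \<inter> unit_square \<noteq> {}" using c by blast
    show "connected (E_interior p m \<inter> unit_square)"
      unfolding int sq using r(1) by (intro convex_connected convex_Int convex_conic_neg convex_box)
    show "openin (top_of_set unit_square) (E_interior p m \<inter> unit_square)"
      unfolding int using open_conic_neg by (auto simp: openin_open)
    show "reduced_depth z = enat k" if "z \<in> E_interior p m \<inter> unit_square" for z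
      using that reduced_depth_E_interior assms by (simp add: k_def)
    fix z assume z: "z \<in> closure (E_interior p m \<inter> unit_square)" "z \<notin> E_interior p m \<inter> unit_square"
    have "closure (E_interior p m \<inter> unit_square) \<subseteq> {z. conic p m z \<le> 0} \<inter> unit_square"
      unfolding int sq by (intro closure_minimal closed_Int closed_conic_nonpos closed_cbox) auto
    then have z': "conic p m z = 0" "z \<in> unit_square" using z int by fastforce+
    show "z \<notin> (top_of_set unit_square) interior_of {z \<in> unit_square. reduced_depth z = enat k}"
    proof
      assume in_int: "z \<in> (top_of_set unit_square) interior_of {z \<in> unit_square. reduced_depth z = enat k}"
      then have "z \<in> {z \<in> unit_square. reduced_depth z = enat k}"
        by (rule subsetD[OF interior_of_subset])
      moreover have "k \<noteq> 0" using k by (cases k) auto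
      moreover have "reduced_depth z = apollonian_depth (1, fst z, snd z)"
        by (simp add: reduced_depth_def case_prod_unfold)
      ultimately have "apollonian_depth (1, fst z, snd z) \<noteq> 0" by (simp add: zero_enat_def)
      \<comment> \<open>Points on the axes, such as the contact point with the x-axis, have depth 0
        and so lie outside the level set of \<open>k\<close>.\<close>
      then have pos: "0 < fst z" "0 < snd z" by (cases z; auto simp: apollonian_depth_eq_0_iff has_nonpos_triple)+
      have w: "((\<lambda>t. z + t *\<^sub>R (z - c)) \<longlongrightarrow> z) (at_right 0)"
      proof -
        have "((\<lambda>t. z + t *\<^sub>R (z - c)) \<longlongrightarrow> z + 0 *\<^sub>R (z - c)) (at_right 0)" by (intro tendsto_intros)
        then show ?thesis by simp
      qed
      note wpos = order_tendstoD(1)[OF tendsto_fst[OF w] pos(1)] order_tendstoD(1)[OF tendsto_snd[OF w] pos(2)]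
      have "\<forall>\<^sub>F t in at_right 0. z + t *\<^sub>R (z - c) \<in> unit_square"
      proof (cases "m = 1")
        case True
        have "\<forall>\<^sub>F t in at_right 0. (0 :: real) < t" by (simp add: eventually_at_right_less)
        then show ?thesis using wpos
        proof eventually_elim
          case (elim t)
          have "t * (fst z - 1) \<le> 0" "t * (snd z - 1) \<le> 0"
            using elim(1) z'(2) by (auto simp: unit_square_def intro!: mult_nonneg_nonpos)
          then show ?case using elim z'(2) c(3)[OF True] by (auto simp: unit_square_def mem_Times_iff)
        qed
      next
        case False
        then have m: "2 \<le> m" using r(1) by simp
        \<comment> \<open>An ellipse meets neither \<open>x = 1\<close> nor \<open>y = 1\<close> at
          such a point, so all bounds of the square are strict at \<open>z\<close> and persist
          nearby.\<close>
        have "p < m" using r(2,5) False by (cases "p = m") auto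
        moreover have "curvature p m (1, fst z, snd z) = 0"
          using curvature_pos_iff(2)[of "fst z" "snd z" m p] pos r(1) z'(1) by simp
        ultimately have "fst z < 1"
          using second_less_first[of 1 "fst z" "snd z" p m] assms(2) pos by simp
        moreover have "snd z < 1" using conic_nonpos_imp[of p m "fst z" "snd z"] z'(1) assms(2) m by simp
        ultimately have "\<forall>\<^sub>F t in at_right 0. fst (z + t *\<^sub>R (z - c)) < 1"
          "\<forall>\<^sub>F t in at_right 0. snd (z + t *\<^sub>R (z - c)) < 1"
          using order_tendstoD(2)[OF tendsto_fst[OF w]] order_tendstoD(2)[OF tendsto_snd[OF w]] by blast+
        then show ?thesis using wpos
          by eventually_elim (auto simp: unit_square_def mem_Times_iff)
      qed
      then show False
        using not_interior_of_level[OF assms z'(1) _ pos k] c(1) in_int int by blast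
    qed
  qed auto
qed

theorem theorem1:
  shows
    "(E_curve 1 1 = {(x, y). 2 * (x + y) = (x - y)\<^sup>2 + 1}) \<and>
     (\<forall>p m. reduced_index p m \<and> 1 \<le> p \<longrightarrow>
       E_curve p m \<subseteq> {(x, y). 0 \<le> y} \<and>
       E_curve p m \<inter> x_axis = {((real p)\<^sup>2 / (real m)\<^sup>2, 0)} \<and>
       tangent_at (E_curve p m) x_axis ((real p)\<^sup>2 / (real m)\<^sup>2, 0)) \<and>
     (\<forall>p m q n. reduced_index p m \<and> reduced_index q n \<and> real p / real m \<noteq> real q / real n \<longrightarrow>
       E_interior p m \<inter> E_interior q n = {}) \<and>
     (\<forall>p m q n. reduced_index p m \<and> reduced_index q n \<and> unimodular p m q n \<longrightarrow>
       is_ellipse (E_curve (p + q) (m + n)) \<and>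
       tangent (E_curve (p + q) (m + n)) (E_curve p m) \<and>
       tangent (E_curve (p + q) (m + n)) (E_curve q n) \<and>
       tangent_at (E_curve (p + q) (m + n)) x_axis ((real (p + q))\<^sup>2 / (real (m + n))\<^sup>2, 0)) \<and>
     (\<forall>p m q n. reduced_index p m \<and> reduced_index q n \<and> unimodular p m q n \<longrightarrow>
       (let z = (((real p)\<^sup>2 + (real q)\<^sup>2 - 1) / ((real m)\<^sup>2 + (real n)\<^sup>2 - 1),
                 1 / ((real m)\<^sup>2 + (real n)\<^sup>2 - 1))
        in E_curve p m \<inter> E_curve q n = {z} \<and> tangent_at (E_curve p m) (E_curve q n) z)) \<and>
     (\<forall>p m. reduced_index p m \<and> 1 \<le> p \<longrightarrow>
       is_plateau (if p = 1 \<and> m = 1 then E_interior p m \<inter> unit_square else E_interior p m) \<and>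
       (\<forall>z \<in> E_interior p m \<inter> unit_square. reduced_depth z = enat (sb_row_number p m)))"
proof (intro conjI allI impI)
  show "E_curve 1 1 = {(x, y). 2 * (x + y) = (x - y)\<^sup>2 + 1}" by (rule E_curve_1_1)
next
  fix p m assume "reduced_index p m \<and> 1 \<le> p"
  then have p: "reduced_index p m" "1 \<le> p" by auto
  note m = reduced_indexD[OF p(1)]
  show "E_curve p m \<subseteq> {(x, y). 0 \<le> y}" using p(2) m(1) by (rule E_curve_nonneg)
  show "E_curve p m \<inter> x_axis = {((real p)\<^sup>2 / (real m)\<^sup>2, 0)}" using p(2) m(1) by (rule E_curve_x_axis)
  show "tangent_at (E_curve p m) x_axis ((real p)\<^sup>2 / (real m)\<^sup>2, 0)" using p by (rule tangent_at_x_axis)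
  show "is_plateau (if p = 1 \<and> m = 1 then E_interior p m \<inter> unit_square else E_interior p m)"
  proof (cases "m = 1")
    case True
    then show ?thesis using is_plateau_E_interior[OF p] m(3) p(2) by simp
  next
    case False
    then have "E_interior p m \<inter> unit_square = E_interior p m"
      using E_interior_subset_unit_square[OF p] m(1) by auto
    then show ?thesis using is_plateau_E_interior[OF p] False by simp
  qed
  show "\<forall>z \<in> E_interior p m \<inter> unit_square. reduced_depth z = enat (sb_row_number p m)"
    using reduced_depth_E_interior[OF _ p] by blast
next
  fix p m q n assume "reduced_index p m \<and> reduced_index q n \<and> real p / real m \<noteq> real q / real n"
  then show "E_interior p m \<inter> E_interior q n = {}" using E_interior_disjoint by blast
next
  fix p m q n assume "reduced_index p m \<and> reduced_index q n \<and> unimodular p m q n"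
  then have a: "reduced_index p m" "reduced_index q n" "unimodular p m q n" by auto
  note r = reduced_index_mediant[OF a]
  have pos: "1 \<le> p + q" "2 \<le> m + n"
    using unimodular_pos[OF a(3)] reduced_indexD(1)[OF a(1)] reduced_indexD(1)[OF a(2)] by auto
  show "is_ellipse (E_curve (p + q) (m + n))" using pos by (rule is_ellipse_E_curve)
  show "tangent_at (E_curve (p + q) (m + n)) x_axis ((real (p + q))\<^sup>2 / (real (m + n))\<^sup>2, 0)"
    using r pos(1) by (rule tangent_at_x_axis)
  show "tangent (E_curve (p + q) (m + n)) (E_curve q n)"
    using tangent_at_contact_point[OF r a(2) unimodular_mediant[OF a(3)]] unfolding tangent_def by blast
  have "unimodular (p + q) (m + n) p m"
    using unimodular_mediant[OF unimodular_sym[OF a(3)]] by (simp add: add.commute)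
  then show "tangent (E_curve (p + q) (m + n)) (E_curve p m)"
    using tangent_at_contact_point[OF r a(1)] unfolding tangent_def by blast
  show "let z = (((real p)\<^sup>2 + (real q)\<^sup>2 - 1) / ((real m)\<^sup>2 + (real n)\<^sup>2 - 1),
                 1 / ((real m)\<^sup>2 + (real n)\<^sup>2 - 1))
        in E_curve p m \<inter> E_curve q n = {z} \<and> tangent_at (E_curve p m) (E_curve q n) z"
    using E_curves_contact[OF a] tangent_at_contact_point[OF a] by (simp add: contact_point_def Let_def)
qed

end
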